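(* Let $\varphi$ be any AV-uniform ABMV rule. Then the problem DCAV for $\varphi$ is W[1]-hard with respect to the parameter $k+\ell+n_{\mathrm{rg}}$, where $n_{\mathrm{rg}}=|V|$ denotes the number of registered votes. This holds even when there is only one distinguished candidate ($|J|=1$) and every vote approves two candidates.
   Context: An election is a pair $(C,V)$, where $C$ is a finite set of candidates and $V$ is a multiset of votes, each vote being a subset of $C$; a vote $v$ approves $c$ if $c\in v$. A $k$-committee is a $k$-element subset of $C$. An approval-based multiwinner voting (ABMV) rule $\varphi$ maps each election $(C,V)$ and integer $k\le|C|$ to a collection $\varphi(C,V,k)$ of $k$-committees of $C$, called the winning $k$-committees of $\varphi$ at $(C,V)$. AV (approval voting) is the ABMV rule that selects all $k$-committees $w$ maximizing $\sum_{v\in V}|v\cap w|$. An ABMV rule $\varphi$ is AV-uniform if for every election $(C,V)$ in which every vote of $V$ approves the same number of candidates and every integer $k\le|C|$, $\varphi(C,V,k)=\mathrm{AV}(C,V,k)$. Destructive Control by Adding Voters (DCAV) for $\varphi$. Input: an election $(C,V\cup U)$ (votes in $V$ are registered, votes in $U$ are unregistered), an integer $k\le|C|$, a nonempty subset $J\subseteq C$ (distinguished candidates), and an integer $\ell\le|U|$. Question: is there $U'\subseteq U$ with $|U'|\le\ell$ such that no candidate of $J$ belongs to any winning $k$-committee of $\varphi$ at $(C,V\cup U')$? *)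

theory Defs
  imports Main "HOL-Library.Multiset"
begin

section \<open>Machine model\<close>

text \<open>
  Data are unlabelled binary trees, and programs are one-variable while programs over such trees
  (in the style of Jones' WHILE language). The cost of a step is the number of nodes of the data it
  reads or copies, so a run of cost \<open>t\<close> only handles trees with at most \<open>t\<close> nodes (in particular its
  result has at most \<open>t\<close> nodes), and costs agree up to a polynomial with Turing machine time.
\<close>

datatype tree = Leaf | Node tree tree

fun nodes :: "tree \<Rightarrow> nat" where
  "nodes Leaf = 1"
| "nodes (Node a b) = 1 + nodes a + nodes b"

fun left :: "tree \<Rightarrow> tree" where
  "left Leaf = Leaf"
| "left (Node a b) = a"

fun right :: "tree \<Rightarrow> tree" where
  "right Leaf = Leaf"
| "right (Node a b) = b"

datatype prog =
    Id | Null | Left | Right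
  | Pair prog prog
  | Seq prog prog
  | Cond prog prog prog
  | While prog prog

text \<open>\<open>runs p x y t\<close>: on input \<open>x\<close> the program \<open>p\<close> halts with output \<open>y\<close> after \<open>t\<close> time units.
  A test counts as false if it returns \<open>Leaf\<close> and as true otherwise.\<close>

inductive runs :: "prog \<Rightarrow> tree \<Rightarrow> tree \<Rightarrow> nat \<Rightarrow> bool" where
  run_Id: "runs Id x x (nodes x)"
| run_Null: "runs Null x Leaf (nodes x)"
| run_Left: "runs Left x (left x) (nodes x)"
| run_Right: "runs Right x (right x) (nodes x)"
| run_Pair: "runs p x a s \<Longrightarrow> runs q x b t \<Longrightarrow> runs (Pair p q) x (Node a b) (nodes x + s + t)"
| run_Seq: "runs p x y s \<Longrightarrow> runs q y z t \<Longrightarrow> runs (Seq p q) x z (s + t)"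
| run_Cond_true:
    "runs b x (Node u v) s \<Longrightarrow> runs p x y t \<Longrightarrow> runs (Cond b p q) x y (nodes x + s + t)"
| run_Cond_false:
    "runs b x Leaf s \<Longrightarrow> runs q x y t \<Longrightarrow> runs (Cond b p q) x y (nodes x + s + t)"
| run_While_false: "runs b x Leaf s \<Longrightarrow> runs (While b p) x x (nodes x + s)"
| run_While_true:
    "runs b x (Node u v) s \<Longrightarrow> runs p x y t \<Longrightarrow> runs (While b p) y z r \<Longrightarrow>
      runs (While b p) x z (nodes x + s + t + r)"


section \<open>Encodings\<close>

text \<open>
  A list is encoded by the right spine of a tree, and a natural number by a list of that length, that
  is, in unary. All numbers below are names or sizes of objects listed explicitly in the same input,
  so unary notation costs at most a polynomial factor after renaming; for a hardness statement it is
  the more demanding choice. Decoding is total, and an object may have several encodings.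
\<close>

fun list_of :: "tree \<Rightarrow> tree list" where
  "list_of Leaf = []"
| "list_of (Node a b) = a # list_of b"

definition nat_of :: "tree \<Rightarrow> nat" where
  "nat_of x = length (list_of x)"

definition nat_list_of :: "tree \<Rightarrow> nat list" where
  "nat_list_of x = map nat_of (list_of x)"

fun tree_of_nat :: "nat \<Rightarrow> tree" where
  "tree_of_nat 0 = Leaf"
| "tree_of_nat (Suc n) = Node Leaf (tree_of_nat n)"


section \<open>Parameterized problems and reductions\<close>

text \<open>A parameterized problem is a set of pairs \<open>(x, k)\<close>, where \<open>k\<close> is the parameter; it is given
  to programs together with \<open>x\<close>.\<close>

type_synonym problem = "(tree \<times> nat) set"

definition computable :: "(nat \<Rightarrow> nat) \<Rightarrow> bool" where
  "computable f \<longleftrightarrow> (\<exists>P. \<forall>n. \<exists>t. runs P (tree_of_nat n) (tree_of_nat (f n)) t)"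

definition fpt_reducible :: "problem \<Rightarrow> problem \<Rightarrow> bool" where
  "fpt_reducible L L' \<longleftrightarrow>
    (\<exists>P f g c. computable f \<and> computable g \<and>
      (\<forall>x k. \<exists>x' k' t.
        runs P (Node x (tree_of_nat k)) (Node x' (tree_of_nat k')) t \<and>
        t \<le> f k * nodes x ^ c \<and>
        k' \<le> g k \<and>
        ((x, k) \<in> L \<longleftrightarrow> (x', k') \<in> L')))"


section \<open>Boolean circuits and the W hierarchy\<close>

text \<open>A circuit is a topologically sorted list of gates, referring to each other by their positions;
  its last gate is the output. The input variables are the positions of the gates \<open>Input\<close>.\<close>

datatype gate = Input | Neg nat | Conj "nat list" | Disj "nat list"

type_synonym circuit = "gate list"

fun preds :: "gate \<Rightarrow> nat list" where
  "preds Input = []"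
| "preds (Neg j) = [j]"
| "preds (Conj js) = js"
| "preds (Disj js) = js"

fun arity_ok :: "gate \<Rightarrow> bool" where
  "arity_ok (Conj js) \<longleftrightarrow> length js \<ge> 2"
| "arity_ok (Disj js) \<longleftrightarrow> length js \<ge> 2"
| "arity_ok _ \<longleftrightarrow> True"

definition wf_circuit :: "circuit \<Rightarrow> bool" where
  "wf_circuit C \<longleftrightarrow>
    C \<noteq> [] \<and> (\<forall>i<length C. arity_ok (C ! i) \<and> (\<forall>j\<in>set (preds (C ! i)). j < i))"

declare conj_cong [fundef_cong]

text \<open>The guards \<open>j < i\<close> serve termination only; they hold in every well-formed circuit.\<close>

fun gate_val :: "circuit \<Rightarrow> nat set \<Rightarrow> nat \<Rightarrow> bool" where
  "gate_val C S i =
    (case C ! i of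
      Input \<Rightarrow> i \<in> S
    | Neg j \<Rightarrow> j < i \<longrightarrow> \<not> gate_val C S j
    | Conj js \<Rightarrow> \<forall>j\<in>set js. j < i \<longrightarrow> gate_val C S j
    | Disj js \<Rightarrow> \<exists>j\<in>set js. j < i \<and> gate_val C S j)"

declare gate_val.simps [simp del]

definition inputs :: "circuit \<Rightarrow> nat set" where
  "inputs C = {i. i < length C \<and> C ! i = Input}"

definition satisfies :: "nat set \<Rightarrow> circuit \<Rightarrow> bool" where
  "satisfies S C \<longleftrightarrow> gate_val C S (length C - 1)"

definition io_path :: "circuit \<Rightarrow> nat list \<Rightarrow> bool" where
  "io_path C p \<longleftrightarrow>
    p \<noteq> [] \<and> set p \<subseteq> {..<length C} \<and> hd p \<in> inputs C \<and> last p = length C - 1 \<and>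
    successively (\<lambda>i j. i \<in> set (preds (C ! j))) p"

text \<open>The depth is the maximal number of edges, and the weft the maximal number of large gates
  (those of fan-in greater than two), on a path from an input to the output.\<close>

definition depth_le :: "nat \<Rightarrow> circuit \<Rightarrow> bool" where
  "depth_le d C \<longleftrightarrow> (\<forall>p. io_path C p \<longrightarrow> length p - 1 \<le> d)"

definition weft_le :: "nat \<Rightarrow> circuit \<Rightarrow> bool" where
  "weft_le t C \<longleftrightarrow>
    (\<forall>p. io_path C p \<longrightarrow> length (filter (\<lambda>i. length (preds (C ! i)) > 2) p) \<le> t)"

fun gate_of :: "tree \<Rightarrow> gate" where
  "gate_of Leaf = Input"
| "gate_of (Node Leaf x) = Neg (nat_of x)"
| "gate_of (Node (Node Leaf _) x) = Conj (nat_list_of x)"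
| "gate_of (Node (Node (Node _ _) _) x) = Disj (nat_list_of x)"

definition circuit_of :: "tree \<Rightarrow> circuit" where
  "circuit_of x = map gate_of (list_of x)"

text \<open>Weighted satisfiability of circuits of weft at most \<open>t\<close> and depth at most \<open>d\<close>, parameterized
  by the weight.\<close>

definition weighted_circuit_sat :: "nat \<Rightarrow> nat \<Rightarrow> problem" where
  "weighted_circuit_sat t d =
    {(x, k). wf_circuit (circuit_of x) \<and> weft_le t (circuit_of x) \<and> depth_le d (circuit_of x) \<and>
      (\<exists>S \<subseteq> inputs (circuit_of x). card S = k \<and> satisfies S (circuit_of x))}"

definition W :: "nat \<Rightarrow> problem set" where
  "W t = {L. \<exists>d. fpt_reducible L (weighted_circuit_sat t d)}"

definition W_hard :: "nat \<Rightarrow> problem \<Rightarrow> bool" where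
  "W_hard t L \<longleftrightarrow> (\<forall>L'\<in>W t. fpt_reducible L' L)"


section \<open>Approval-based multiwinner voting\<close>

text \<open>Candidates are drawn from the natural numbers.\<close>

type_synonym vote = "nat set"

type_synonym rule = "nat set \<Rightarrow> vote multiset \<Rightarrow> nat \<Rightarrow> nat set set"

definition election :: "nat set \<Rightarrow> vote multiset \<Rightarrow> bool" where
  "election C V \<longleftrightarrow> finite C \<and> (\<forall>v\<in>#V. v \<subseteq> C)"

definition committees :: "nat set \<Rightarrow> nat \<Rightarrow> nat set set" where
  "committees C k = {w. w \<subseteq> C \<and> card w = k}"

definition ABMV_rule :: "rule \<Rightarrow> bool" where
  "ABMV_rule \<phi> \<longleftrightarrow>
    (\<forall>C V k. election C V \<longrightarrow> k \<le> card C \<longrightarrow> \<phi> C V k \<subseteq> committees C k)"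

definition AV_score :: "vote multiset \<Rightarrow> nat set \<Rightarrow> nat" where
  "AV_score V w = (\<Sum>v\<in>#V. card (v \<inter> w))"

definition AV :: rule where
  "AV C V k =
    {w \<in> committees C k. \<forall>w'\<in>committees C k. AV_score V w' \<le> AV_score V w}"

definition AV_uniform :: "rule \<Rightarrow> bool" where
  "AV_uniform \<phi> \<longleftrightarrow>
    (\<forall>C V k. election C V \<longrightarrow> (\<exists>r. \<forall>v\<in>#V. card v = r) \<longrightarrow> k \<le> card C \<longrightarrow>
      \<phi> C V k = AV C V k)"


section \<open>Destructive control by adding voters\<close>

record dcav_instance =
  candidates :: "nat set"
  registered :: "vote multiset"
  unregistered :: "vote multiset"
  committee_size :: nat
  distinguished :: "nat set"
  budget :: nat

definition valid_instance :: "dcav_instance \<Rightarrow> bool" where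
  "valid_instance I \<longleftrightarrow>
    election (candidates I) (registered I + unregistered I) \<and>
    committee_size I \<le> card (candidates I) \<and>
    distinguished I \<noteq> {} \<and> distinguished I \<subseteq> candidates I \<and>
    budget I \<le> size (unregistered I)"

definition controllable :: "rule \<Rightarrow> dcav_instance \<Rightarrow> bool" where
  "controllable \<phi> I \<longleftrightarrow>
    (\<exists>U'. U' \<subseteq># unregistered I \<and> size U' \<le> budget I \<and>
      (\<forall>w \<in> \<phi> (candidates I) (registered I + U') (committee_size I).
        distinguished I \<inter> w = {}))"

definition cand_set_of :: "tree \<Rightarrow> nat set" where
  "cand_set_of x = set (nat_list_of x)"

definition votes_of :: "tree \<Rightarrow> vote multiset" where
  "votes_of x = image_mset cand_set_of (mset (list_of x))"

text \<open>An instance is encoded as a tuple nested to the right.\<close>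

definition dcav_of :: "tree \<Rightarrow> dcav_instance" where
  "dcav_of x =
    \<lparr> candidates = cand_set_of (left x),
      registered = votes_of (left (right x)),
      unregistered = votes_of (left (right (right x))),
      committee_size = nat_of (left (right (right (right x)))),
      distinguished = cand_set_of (left (right (right (right (right x))))),
      budget = nat_of (right (right (right (right (right x))))) \<rparr>"

definition DCAV :: "rule \<Rightarrow> problem" where
  "DCAV \<phi> =
    {(x, p). valid_instance (dcav_of x) \<and>
      p = committee_size (dcav_of x) + budget (dcav_of x) + size (registered (dcav_of x)) \<and>
      controllable \<phi> (dcav_of x)}"

text \<open>The restriction to one distinguished candidate and votes approving exactly two candidates.\<close>

definition DCAV_restricted :: "rule \<Rightarrow> problem" where
  "DCAV_restricted \<phi> =
    {(x, p) \<in> DCAV \<phi>. card (distinguished (dcav_of x)) = 1 \<and>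
      (\<forall>v \<in># registered (dcav_of x) + unregistered (dcav_of x). card v = 2)}"

end

theory Submission
  imports Defs
begin

text \<open>
  Weighted satisfiability of circuits of weft one and depth \<open>d\<close> reduces to the clique problem, and
  the latter to DCAV.

  Fix a set of \<open>k\<close> inputs. Whether an input belongs to the set can be read off from the gap between
  consecutive elements of the set in which it lies, so a partial assignment is a list of gaps (tokens).
  Below a large gate everything has bounded fan-in and depth, so a false predecessor of a conjunction, or a
  true one of a disjunction, is certified by \<open>2 ^ d\<close> tokens, and so is the value of the whole circuit,
  provided that large gates which are not refuted get their default value. Therefore the set
  satisfies the circuit iff there are \<open>q = 2 ^ d\<close> tokens such that the circuit evaluates to true whenever
  these and \<open>q\<close> further ones are known. A clique of size \<open>(k + 3) ^ q\<close> lists all choices of the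
  latter, with adjacency forcing consistency.

  For a clique of size \<open>\<kappa>\<close>, the unregistered votes are the edges, and the distinguished candidate gets
  \<open>\<kappa> - 2\<close> approvals: to lift \<open>\<kappa>\<close> vertices above it by \<open>\<kappa> choose 2\<close> edges one needs a complete graph. All
  votes have size two, so the rule coincides with approval voting.
\<close>

section \<open>Polynomial-time functions on trees\<close>

text \<open>The obstacle is that evaluation with defaults is not monotone in the known tokens: a
  large conjunction is believed until refuted, so a false circuit may look true when little is
  known, and guessing \<open>q\<close> tokens alone would be unsound. Two facts repair this. Below a
  large gate there is no other one, so whatever is known there is correct and a default is withdrawn
  only rightly. And a token set containing a certificate yields the right value however many correct
  tokens are added. So if the circuit is satisfied, sharing a certificate makes every extension
  evaluate to true; if it is not, some extension contains the certificate of falsity and evaluates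
  to false. The bound \<open>2 ^ d\<close> arises because a small gate needs the certificates of at
  most two predecessors, and a large gate that of at most one. The base \<open>k + 3\<close> counts
  the slots from 0 to \<open>k + 2\<close>; it gives a clique size \<kappa> of at least 3, so that a
  dummy candidate, approved once, never beats the distinguished one with its
  \<open>\<kappa> - 2\<close> approvals. For fixed \<open>d\<close> the whole translation takes
  polynomial time, the parameter being part of the input in unary.\<close>

lemma nodes_pos [simp]: "0 < nodes x"
  by (cases x) auto

lemma nodes_ge_1: "Suc 0 \<le> nodes x"
  by (cases x) auto

lemma nodes_left: "nodes (left x) \<le> nodes x"
  by (cases x) auto

lemma nodes_right: "nodes (right x) \<le> nodes x"
  by (cases x) auto

lemma runs_nodes: "runs P x y t \<Longrightarrow> nodes x \<le> t \<and> nodes y \<le> t"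
proof (induction rule: runs.induct)
  case (run_Pair p x a s q b t)
  then show ?case using nodes_ge_1[of x] by simp
qed (use nodes_left nodes_right nodes_ge_1 in \<open>auto intro: le_trans\<close>)

text \<open>One constant serves as coefficient and exponent. This loses nothing because
  \<open>nodes x\<close> is at least 1, see \<open>pbI\<close>.\<close>

definition pb :: "(tree \<Rightarrow> nat) \<Rightarrow> bool" where
  "pb h \<longleftrightarrow> (\<exists>c. \<forall>x. h x \<le> c * nodes x ^ c)"

lemma pb_mono: "pb g \<Longrightarrow> (\<And>x. h x \<le> g x) \<Longrightarrow> pb h"
  unfolding pb_def by (meson le_trans)

lemma pbI: assumes "\<And>x. h x \<le> a * nodes x ^ b" shows "pb h"
  unfolding pb_def
proof (intro exI allI)
  fix x
  have "h x \<le> a * nodes x ^ b" by fact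
  also have "\<dots> \<le> max a b * nodes x ^ max a b"
    by (intro mult_mono power_increasing) (auto simp: Suc_le_eq)
  finally show "h x \<le> max a b * nodes x ^ max a b" .
qed

lemma pb_const: "pb (\<lambda>x. n)"
  by (rule pbI[of _ n 0]) simp

lemma pb_nodes: "pb nodes"
  by (rule pbI[of _ 1 1]) simp

lemma pb_add: assumes "pb f" "pb g" shows "pb (\<lambda>x. f x + g x)"
proof -
  obtain a b where f: "\<And>x. f x \<le> a * nodes x ^ a" and g: "\<And>x. g x \<le> b * nodes x ^ b"
    using assms unfolding pb_def by blast
  show ?thesis
  proof (rule pbI)
    fix x
    have "a * nodes x ^ a \<le> a * nodes x ^ max a b" "b * nodes x ^ b \<le> b * nodes x ^ max a b"
      by (intro mult_left_mono power_increasing; simp add: Suc_le_eq)+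
    then show "f x + g x \<le> (a + b) * nodes x ^ max a b"
      using f[of x] g[of x] unfolding add_mult_distrib by linarith
  qed
qed

lemma pb_mult: assumes "pb f" "pb g" shows "pb (\<lambda>x. f x * g x)"
proof -
  obtain a b where f: "\<And>x. f x \<le> a * nodes x ^ a" and g: "\<And>x. g x \<le> b * nodes x ^ b"
    using assms unfolding pb_def by blast
  show ?thesis
  proof (rule pbI)
    fix x
    have "f x * g x \<le> (a * nodes x ^ a) * (b * nodes x ^ b)"
      by (intro mult_mono f g) auto
    then show "f x * g x \<le> (a * b) * nodes x ^ (a + b)"
      by (simp add: power_add algebra_simps)
  qed
qed

lemma pb_power: "pb f \<Longrightarrow> pb (\<lambda>x. f x ^ n)"
  by (induction n) (auto intro: pb_const pb_mult)

lemma pb_comp: assumes "pb h" "pb (\<lambda>x. nodes (f x))" shows "pb (\<lambda>x. h (f x))"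
proof -
  obtain a where a: "\<And>x. h x \<le> a * nodes x ^ a"
    using assms unfolding pb_def by blast
  show ?thesis
    by (rule pb_mono[OF pb_mult[OF pb_const[of a] pb_power[OF assms(2), of a]]]) (rule a)
qed

definition fp :: "(tree \<Rightarrow> tree) \<Rightarrow> bool" where
  "fp f \<longleftrightarrow> (\<exists>P T. pb T \<and> (\<forall>x. \<exists>t\<le>T x. runs P x (f x) t))"

lemma fpE:
  assumes "fp f"
  obtains P c where "\<And>x. \<exists>t\<le>c * nodes x ^ c. runs P x (f x) t"
  using assms unfolding fp_def pb_def by (meson le_trans)

text \<open>The cost of a run bounds the size of its result, so a time bound is also a size bound.
  Composition stays polynomial for this reason.\<close>

lemma fp_pb: assumes "fp f" shows "pb (\<lambda>x. nodes (f x))"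
proof -
  obtain P T where T: "pb T" and r: "\<And>x. \<exists>t\<le>T x. runs P x (f x) t"
    using assms unfolding fp_def by blast
  show ?thesis
    by (rule pb_mono[OF T]) (use r runs_nodes le_trans in blast)
qed

lemma fp_id: "fp (\<lambda>x. x)"
  unfolding fp_def using pb_nodes run_Id by blast

lemma fp_Leaf: "fp (\<lambda>x. Leaf)"
  unfolding fp_def using pb_nodes run_Null by blast

lemma fp_comp: assumes "fp f" "fp g" shows "fp (\<lambda>x. f (g x))"
proof -
  obtain P T where T: "pb T" and P: "\<And>x. \<exists>t\<le>T x. runs P x (f x) t"
    using assms unfolding fp_def by blast
  obtain Q U where U: "pb U" and Q: "\<And>x. \<exists>t\<le>U x. runs Q x (g x) t"
    using assms unfolding fp_def by blast
  have "\<exists>t\<le>U x + T (g x). runs (Seq Q P) x (f (g x)) t" for x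
    using Q[of x] P[of "g x"] run_Seq add_mono by metis
  moreover have "pb (\<lambda>x. U x + T (g x))"
    by (intro pb_add U pb_comp[OF T] fp_pb assms)
  ultimately show ?thesis unfolding fp_def by blast
qed

lemma fp_left: "fp f \<Longrightarrow> fp (\<lambda>x. left (f x))"
  by (rule fp_comp[of left]) (use pb_nodes run_Left in \<open>unfold fp_def, blast\<close>)

lemma fp_right: "fp f \<Longrightarrow> fp (\<lambda>x. right (f x))"
  by (rule fp_comp[of right]) (use pb_nodes run_Right in \<open>unfold fp_def, blast\<close>)

lemma fp_Node: assumes "fp f" "fp g" shows "fp (\<lambda>x. Node (f x) (g x))"
proof -
  obtain P T where T: "pb T" and P: "\<And>x. \<exists>t\<le>T x. runs P x (f x) t"
    using assms unfolding fp_def by blast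
  obtain Q U where U: "pb U" and Q: "\<And>x. \<exists>t\<le>U x. runs Q x (g x) t"
    using assms unfolding fp_def by blast
  have "\<exists>t\<le>nodes x + T x + U x. runs (Pair P Q) x (Node (f x) (g x)) t" for x
    using Q[of x] P[of x] run_Pair add_mono by (metis le_refl)
  moreover have "pb (\<lambda>x. nodes x + T x + U x)"
    by (intro pb_add U T pb_nodes)
  ultimately show ?thesis unfolding fp_def by blast
qed

lemma fp_const: "fp (\<lambda>x. a)"
  by (induction a) (auto intro: fp_Leaf fp_Node)

lemma fp_cond:
  assumes "fp b" "fp f" "fp g"
  shows "fp (\<lambda>x. if b x = Leaf then g x else f x)"
proof -
  obtain B R where R: "pb R" and B: "\<And>x. \<exists>t\<le>R x. runs B x (b x) t"
    using assms unfolding fp_def by blast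
  obtain P T where T: "pb T" and P: "\<And>x. \<exists>t\<le>T x. runs P x (f x) t"
    using assms unfolding fp_def by blast
  obtain Q U where U: "pb U" and Q: "\<And>x. \<exists>t\<le>U x. runs Q x (g x) t"
    using assms unfolding fp_def by blast
  have "\<exists>t\<le>nodes x + R x + (T x + U x). runs (Cond B P Q) x (if b x = Leaf then g x else f x) t" for x
  proof -
    obtain s where s: "s \<le> R x" "runs B x (b x) s" using B by blast
    obtain t where t: "t \<le> T x" "runs P x (f x) t" using P by blast
    obtain u where u: "u \<le> U x" "runs Q x (g x) u" using Q by blast
    show ?thesis
    proof (cases "b x")
      case Leaf
      then have "runs (Cond B P Q) x (g x) (nodes x + s + u)"
        using s u run_Cond_false by metis
      moreover have "nodes x + s + u \<le> nodes x + R x + (T x + U x)" using s u by simp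
      ultimately show ?thesis using Leaf by (intro exI[of _ "nodes x + s + u"]) simp
    next
      case (Node a c)
      then have "runs (Cond B P Q) x (f x) (nodes x + s + t)"
        using s t run_Cond_true by metis
      moreover have "nodes x + s + t \<le> nodes x + R x + (T x + U x)" using s t by simp
      ultimately show ?thesis using Node by (intro exI[of _ "nodes x + s + t"]) simp
    qed
  qed
  moreover have "pb (\<lambda>x. nodes x + R x + (T x + U x))"
    by (intro pb_add U T R pb_nodes)
  ultimately show ?thesis unfolding fp_def by blast
qed

text \<open>Each of the \<open>i\<close> rounds and the final test is charged at the common bound
  \<open>m\<close> on all intermediate stores. The costs of test and body are explicit monomials
  because a general \<open>pb\<close> bound need not be monotone and could not be evaluated at
  \<open>m\<close>.\<close>

lemma runs_While:
  assumes B: "\<And>x. \<exists>t\<le>cb * nodes x ^ cb. runs B x (b x) t"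
    and H: "\<And>x. \<exists>t\<le>ch * nodes x ^ ch. runs H x (h x) t"
  shows "\<lbrakk>b ((h ^^ i) s) = Leaf; \<And>j. j < i \<Longrightarrow> b ((h ^^ j) s) \<noteq> Leaf;
      \<And>j. j \<le> i \<Longrightarrow> nodes ((h ^^ j) s) \<le> m\<rbrakk> \<Longrightarrow>
    \<exists>t\<le>(i + 1) * (m + cb * m ^ cb + ch * m ^ ch). runs (While B H) s ((h ^^ i) s) t"
proof (induction i arbitrary: s)
  case 0
  obtain t where t: "t \<le> cb * nodes s ^ cb" "runs B s (b s) t" using B by blast
  have m: "nodes s \<le> m" using 0(3)[of 0] by simp
  have "cb * nodes s ^ cb \<le> cb * m ^ cb" using m by (intro mult_left_mono power_mono) auto
  then have "nodes s + t \<le> (0 + 1) * (m + cb * m ^ cb + ch * m ^ ch)" using t m unfolding add_0 mult_1 by linarith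
  moreover have "runs (While B H) s s (nodes s + t)"
    using t(2) 0(1) run_While_false by simp
  ultimately show ?case by auto
next
  case (Suc i)
  obtain t where t: "t \<le> cb * nodes s ^ cb" "runs B s (b s) t" using B by blast
  obtain u where u: "u \<le> ch * nodes s ^ ch" "runs H s (h s) u" using H by blast
  have m: "nodes s \<le> m" using Suc.prems(3)[of 0] by simp
  have e1: "cb * nodes s ^ cb \<le> cb * m ^ cb" using m by (intro mult_left_mono power_mono) auto
  have e2: "ch * nodes s ^ ch \<le> ch * m ^ ch" using m by (intro mult_left_mono power_mono) auto
  have sh: "(h ^^ j) (h s) = (h ^^ Suc j) s" for j by (simp add: funpow_swap1)
  obtain r where r: "r \<le> (i + 1) * (m + cb * m ^ cb + ch * m ^ ch)"
      "runs (While B H) (h s) ((h ^^ i) (h s)) r"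
    using Suc.IH[of "h s"] Suc.prems unfolding sh by (meson Suc_le_mono Suc_less_eq)
  obtain v w where vw: "b s = Node v w"
    using Suc.prems(2)[of 0] by (cases "b s") auto
  have "runs (While B H) s ((h ^^ Suc i) s) (nodes s + t + u + r)"
    using run_While_true[OF _ u(2) r(2)] t(2) vw sh by metis
  moreover have "nodes s + t + u + r \<le> (Suc i + 1) * (m + cb * m ^ cb + ch * m ^ ch)"
  proof -
    define R where "R = m + cb * m ^ cb + ch * m ^ ch"
    have "nodes s + t + u \<le> R" using t(1) u(1) e1 e2 m unfolding R_def by linarith
    moreover have "(Suc i + 1) * R = R + (i + 1) * R" by simp
    ultimately show ?thesis using r(1) unfolding R_def[symmetric] by linarith
  qed
  ultimately show ?case by blast
qed

text \<open>Polynomially many rounds of a polynomial body do not suffice, as the store could be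
  squared in each round. Hence the separate bound \<open>M\<close> on every intermediate
  store.\<close>

lemma fp_loop:
  assumes fp: "fp b" "fp h" "fp s" and pb: "pb N" "pb M"
    and "\<And>e. i e \<le> N e" "\<And>e. b ((h ^^ i e) (s e)) = Leaf"
      "\<And>e j. j < i e \<Longrightarrow> b ((h ^^ j) (s e)) \<noteq> Leaf"
      "\<And>e j. j \<le> i e \<Longrightarrow> nodes ((h ^^ j) (s e)) \<le> M e"
  shows "fp (\<lambda>e. (h ^^ i e) (s e))"
proof -
  obtain B cb where B: "\<And>x. \<exists>t\<le>cb * nodes x ^ cb. runs B x (b x) t" using fp(1) by (rule fpE) blast
  obtain H ch where H: "\<And>x. \<exists>t\<le>ch * nodes x ^ ch. runs H x (h x) t" using fp(2) by (rule fpE) blast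
  obtain P T where T: "pb T" and P: "\<And>x. \<exists>t\<le>T x. runs P x (s x) t"
    using fp(3) unfolding fp_def by blast
  let ?R = "\<lambda>e. T e + (N e + 1) * (M e + cb * M e ^ cb + ch * M e ^ ch)"
  have "\<exists>t\<le>?R e. runs (Seq P (While B H)) e ((h ^^ i e) (s e)) t" for e
  proof -
    obtain t where t: "t \<le> T e" "runs P e (s e) t" using P by blast
    obtain u where u: "u \<le> (i e + 1) * (M e + cb * M e ^ cb + ch * M e ^ ch)"
        "runs (While B H) (s e) ((h ^^ i e) (s e)) u"
      using runs_While[OF B H, of "i e" "s e" "M e"] assms by blast
    have "(i e + 1) * (M e + cb * M e ^ cb + ch * M e ^ ch)
        \<le> (N e + 1) * (M e + cb * M e ^ cb + ch * M e ^ ch)"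
      using assms(6)[of e] by (intro mult_right_mono) auto
    then have "t + u \<le> ?R e" using t(1) u(1) by linarith
    then show ?thesis using run_Seq[OF t(2) u(2)] by blast
  qed
  moreover have "pb ?R"
    by (intro pb_add pb_mult pb_const pb_power T pb)
  ultimately show ?thesis unfolding fp_def by blast
qed

subsection \<open>Lists\<close>

fun tol :: "tree list \<Rightarrow> tree" where
  "tol [] = Leaf"
| "tol (x # xs) = Node x (tol xs)"

lemma list_of_tol [simp]: "list_of (tol xs) = xs"
  by (induction xs) auto

lemma tol_list_of [simp]: "tol (list_of x) = x"
  by (induction x) auto

lemma tol_eq_Leaf [simp]: "tol xs = Leaf \<longleftrightarrow> xs = []"
  by (cases xs) auto

lemma tol_append_nodes: "nodes (tol (xs @ ys)) + 1 = nodes (tol xs) + nodes (tol ys)"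
  by (induction xs) auto

lemma nodes_tol_rev [simp]: "nodes (tol (rev xs)) = nodes (tol xs)"
proof (induction xs)
  case (Cons x xs)
  then show ?case using tol_append_nodes[of "rev xs" "[x]"] by simp
qed simp

lemma nodes_elem: "y \<in> set xs \<Longrightarrow> nodes y \<le> nodes (tol xs)"
  by (induction xs) auto

lemma length_nodes: "length xs \<le> nodes (tol xs)"
  by (induction xs) auto

lemma nodes_drop: "nodes (tol (drop j xs)) \<le> nodes (tol xs)"
proof (induction xs arbitrary: j)
  case (Cons a xs)
  then show ?case by (cases j) (auto intro: le_SucI trans_le_add2)
qed simp

definition fpl :: "(tree \<Rightarrow> tree list) \<Rightarrow> bool" where
  "fpl L \<longleftrightarrow> fp (\<lambda>e. tol (L e))"

lemma fpl_list_of: "fp f \<Longrightarrow> fpl (\<lambda>e. list_of (f e))"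
  by (simp add: fpl_def)

lemma fp_tol: "fpl L \<Longrightarrow> fp (\<lambda>e. tol (L e))"
  by (simp add: fpl_def)

lemma fpl_Nil: "fpl (\<lambda>e. [])"
  by (simp add: fpl_def fp_Leaf)

lemma fpl_Cons: "fp f \<Longrightarrow> fpl L \<Longrightarrow> fpl (\<lambda>e. f e # L e)"
  by (simp add: fpl_def fp_Node)

lemma fp_foldl:
  assumes L: "fpl L" and a: "fp a"
    and g: "fp (\<lambda>z. g (left z) (left (right z)) (right (right z)))"
    and M: "pb M" "\<And>e j. nodes (foldl (g e) (a e) (take j (L e))) \<le> M e"
  shows "fp (\<lambda>e. foldl (g e) (a e) (L e))"
proof -
  \<comment> \<open>The store consists of the unread part of the list, the original input and the
    accumulator. Its \<open>left\<close> is \<open>Leaf\<close> exactly when the list is used up, so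
    \<open>left\<close> is the loop test.\<close>
  define h where "h z = Node (right (left z)) (Node (left (right z))
      (g (left (right z)) (right (right z)) (left (left z))))" for z
  define s where "s e = Node (tol (L e)) (Node e (a e))" for e
  have it: "(h ^^ j) (s e) = Node (tol (drop j (L e))) (Node e (foldl (g e) (a e) (take j (L e))))"
    if "j \<le> length (L e)" for j e
    using that
  proof (induction j)
    case (Suc j)
    then have *: "drop j (L e) = L e ! j # drop (Suc j) (L e)" "j < length (L e)"
      by (auto simp: Cons_nth_drop_Suc)
    show ?case using Suc * by (simp add: h_def take_Suc_conv_app_nth)
  qed (simp add: s_def)
  have fs: "fp s" unfolding s_def using L a by (auto intro!: fp_Node fp_id simp: fpl_def)
  have "fp h"
  proof -
    have "fp (\<lambda>z. Node (left (right z)) (Node (right (right z)) (left (left z))))"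
      by (intro fp_Node fp_left fp_right fp_id)
    from fp_comp[OF g this] have "fp (\<lambda>z. g (left (right z)) (right (right z)) (left (left z)))"
      by simp
    then show ?thesis unfolding h_def by (intro fp_Node fp_left fp_right fp_id)
  qed
  have Lb: "pb (\<lambda>e. nodes (tol (L e)))" using fp_pb L unfolding fpl_def by blast
  have "fp (\<lambda>e. (h ^^ length (L e)) (s e))"
  proof (rule fp_loop[where b = left and N = "\<lambda>e. nodes (tol (L e))"
        and M = "\<lambda>e. 1 + nodes (tol (L e)) + (1 + nodes e + M e)"])
    show "fp left" using fp_left[OF fp_id] .
    show "length (L e) \<le> nodes (tol (L e))" for e by (rule length_nodes)
    show "nodes ((h ^^ j) (s e)) \<le> 1 + nodes (tol (L e)) + (1 + nodes e + M e)"
      if "j \<le> length (L e)" for e j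
      using M(2)[of e j] nodes_drop[of j "L e"] by (simp add: it[OF that])
    show "pb (\<lambda>e. 1 + nodes (tol (L e)) + (1 + nodes e + M e))"
      by (intro pb_add pb_const pb_nodes Lb M)
  qed (use fs \<open>fp h\<close> Lb it in auto)
  from fp_right[OF fp_right[OF this]] show ?thesis by (simp add: it)
qed

lemma foldl_Node: "foldl (\<lambda>acc y. Node y acc) a xs = tol (rev xs @ list_of a)"
  by (induction xs arbitrary: a) auto

text \<open>A fold that pushes the elements of \<open>L\<close> onto \<open>K\<close> reverses them
  on the way. Reversal is the case of empty \<open>K\<close>, and plain append reverses
  twice.\<close>

lemma fpl_rev_append: assumes "fpl L" "fpl K" shows "fpl (\<lambda>e. rev (L e) @ K e)"
proof -
  have bound: "nodes (tol (rev (take j xs) @ ys)) \<le> nodes (tol xs) + nodes (tol ys)" for j xs ys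
  proof -
    have "nodes (tol (take j xs)) \<le> nodes (tol xs)"
      using tol_append_nodes[of "take j xs" "drop j xs"] nodes_ge_1[of "tol (drop j xs)"] by simp
    then show ?thesis using tol_append_nodes[of "rev (take j xs)" ys] by simp
  qed
  have "fp (\<lambda>e. foldl (\<lambda>acc y. Node y acc) (tol (K e)) (L e))"
  proof (rule fp_foldl[where M = "\<lambda>e. nodes (tol (L e)) + nodes (tol (K e))"])
    show "nodes (foldl (\<lambda>acc y. Node y acc) (tol (K e)) (take j (L e))) \<le> nodes (tol (L e)) + nodes (tol (K e))"
      for e j by (simp add: foldl_Node bound)
  qed (use assms in \<open>auto simp: fpl_def intro!: fp_Node fp_left fp_right fp_id pb_add fp_pb\<close>)
  then show ?thesis by (simp add: foldl_Node fpl_def)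
qed

lemma fpl_rev: "fpl L \<Longrightarrow> fpl (\<lambda>e. rev (L e))"
  using fpl_rev_append[OF _ fpl_Nil] by simp

lemma fpl_append: "fpl L \<Longrightarrow> fpl K \<Longrightarrow> fpl (\<lambda>e. L e @ K e)"
  using fpl_rev_append[OF fpl_rev] by simp

text \<open>The hypothesis on \<open>g\<close> encodes a binder: the body is a program whose input
  pairs the environment \<open>e\<close> with the current element, so nested loops can still refer
  to outer variables.\<close>

lemma fpl_concat_map:
  assumes L: "fpl L" and g: "fpl (\<lambda>z. g (left z) (right z))"
  shows "fpl (\<lambda>e. concat (map (g e) (L e)))"
proof -
  define st where "st e acc y = tol (rev (g e y) @ list_of acc)" for e acc y
  have fold: "foldl (st e) a xs = tol (rev (concat (map (g e) xs)) @ list_of a)" for e a xs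
    by (induction xs arbitrary: a) (auto simp: st_def)
  obtain c where c: "\<And>z. nodes (tol (g (left z) (right z))) \<le> c * nodes z ^ c"
    using fp_pb[OF g[unfolded fpl_def]] unfolding pb_def by blast
  define m where "m e = c * (1 + nodes e + nodes (tol (L e))) ^ c" for e
  have gm: "nodes (tol (g e y)) \<le> m e" if "y \<in> set (L e)" for e y
  proof -
    have "nodes (tol (g e y)) \<le> c * nodes (Node e y) ^ c" using c[of "Node e y"] by simp
    also have "\<dots> \<le> m e"
      unfolding m_def using nodes_elem[OF that] by (intro mult_left_mono power_mono) auto
    finally show ?thesis .
  qed
  have bound: "nodes (tol (rev (concat (map (g e) xs)))) \<le> 1 + length xs * m e"
    if "set xs \<subseteq> set (L e)" for e xs
    using that
  proof (induction xs)
    case (Cons x xs)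
    show ?case
      using Cons gm[of x e] tol_append_nodes[of "g e x" "concat (map (g e) xs)"]
      by (simp del: rev_append)
  qed simp
  have "fp (\<lambda>e. foldl (st e) Leaf (L e))"
  proof (rule fp_foldl[where M = "\<lambda>e. 1 + nodes (tol (L e)) * m e"])
    have "fpl (\<lambda>z. g (left z) (right (right z)))"
    proof -
      have "fp (\<lambda>z. Node (left z) (right (right z)))"
        by (intro fp_Node fp_left fp_right fp_id)
      from fp_comp[OF g[unfolded fpl_def] this] show ?thesis by (simp add: fpl_def)
    qed
    then show "fp (\<lambda>z. st (left z) (left (right z)) (right (right z)))"
      unfolding st_def by (intro fp_tol fpl_rev_append fpl_list_of fp_left fp_right fp_id)
    have "pb (\<lambda>e. nodes (tol (L e)))" using fp_pb L unfolding fpl_def by blast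
    then show "pb (\<lambda>e. 1 + nodes (tol (L e)) * m e)"
      unfolding m_def by (intro pb_add pb_mult pb_power pb_const pb_nodes)
    show "nodes (foldl (st e) Leaf (take j (L e))) \<le> 1 + nodes (tol (L e)) * m e" for e j
    proof -
      have "nodes (foldl (st e) Leaf (take j (L e))) \<le> 1 + length (take j (L e)) * m e"
        using bound[OF set_take_subset] by (simp add: fold)
      also have "\<dots> \<le> 1 + nodes (tol (L e)) * m e"
        using length_nodes[of "L e"] by (intro add_left_mono mult_right_mono) auto
      finally show ?thesis .
    qed
  qed (use L fp_Leaf in auto)
  then have "fpl (\<lambda>e. rev (concat (map (g e) (L e))))"
    by (simp add: fold fpl_def)
  from fpl_rev[OF this] show ?thesis by simp
qed

lemma fpl_map:
  assumes "fpl L" "fp (\<lambda>z. g (left z) (right z))"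
  shows "fpl (\<lambda>e. map (g e) (L e))"
proof -
  have "fpl (\<lambda>e. concat (map (\<lambda>y. [g e y]) (L e)))"
    by (rule fpl_concat_map[OF assms(1)]) (intro fpl_Cons fpl_Nil assms)
  then show ?thesis by simp
qed

subsection \<open>Booleans and numbers\<close>

definition fpb :: "(tree \<Rightarrow> bool) \<Rightarrow> bool" where
  "fpb p \<longleftrightarrow> fp (\<lambda>e. if p e then Node Leaf Leaf else Leaf)"

lemma fp_if: assumes "fpb p" "fp f" "fp g" shows "fp (\<lambda>e. if p e then f e else g e)"
proof -
  have "(\<lambda>e. if p e then f e else g e) =
    (\<lambda>e. if (if p e then Node Leaf Leaf else Leaf) = Leaf then g e else f e)" by auto
  then show ?thesis using fp_cond[OF assms(1)[unfolded fpb_def] assms(2,3)] by simp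
qed

lemma fpl_if: assumes "fpb p" "fpl f" "fpl g" shows "fpl (\<lambda>e. if p e then f e else g e)"
proof -
  have "(\<lambda>e. tol (if p e then f e else g e)) = (\<lambda>e. if p e then tol (f e) else tol (g e))" by auto
  then show ?thesis using fp_if assms by (simp add: fpl_def)
qed

lemma fpb_if: assumes "fpb p" "fpb f" "fpb g" shows "fpb (\<lambda>e. if p e then f e else g e)"
proof -
  have "(\<lambda>e. if (if p e then f e else g e) then Node Leaf Leaf else Leaf) = (\<lambda>e. if p e then
    (if f e then Node Leaf Leaf else Leaf) else (if g e then Node Leaf Leaf else Leaf))" by auto
  then show ?thesis using fp_if assms by (simp add: fpb_def)
qed

lemma fpb_const: "fpb (\<lambda>e. b)"
  by (simp add: fpb_def fp_const)

lemma fpb_not: "fpb p \<Longrightarrow> fpb (\<lambda>e. \<not> p e)"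
  using fpb_if[OF _ fpb_const[of False] fpb_const[of True], of p] by (simp add: if_bool_eq_conj)

lemma fpb_conj: "fpb p \<Longrightarrow> fpb q \<Longrightarrow> fpb (\<lambda>e. p e \<and> q e)"
proof -
  have "(\<lambda>e. p e \<and> q e) = (\<lambda>e. if p e then q e else False)" by auto
  then show "fpb p \<Longrightarrow> fpb q \<Longrightarrow> fpb (\<lambda>e. p e \<and> q e)"
    using fpb_if fpb_const by simp
qed

lemma fpb_imp: "fpb p \<Longrightarrow> fpb q \<Longrightarrow> fpb (\<lambda>e. p e \<longrightarrow> q e)"
  using fpb_if[OF _ _ fpb_const[of True], of p q] by (simp add: if_bool_eq_conj)

lemma fpb_eq_Leaf: "fp f \<Longrightarrow> fpb (\<lambda>e. f e = Leaf)"
  unfolding fpb_def by (intro fp_cond fp_const)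

lemma fpl_filter:
  assumes "fpl L" "fpb (\<lambda>z. p (left z) (right z))"
  shows "fpl (\<lambda>e. filter (p e) (L e))"
proof -
  have "fpl (\<lambda>e. concat (map (\<lambda>y. if p e y then [y] else []) (L e)))"
    by (rule fpl_concat_map[OF assms(1)]) (intro fpl_if fpl_Cons fpl_Nil fp_right fp_id assms)
  moreover have "concat (map (\<lambda>y. if p e y then [y] else []) xs) = filter (p e) xs" for e xs
    by (induction xs) auto
  ultimately show ?thesis by simp
qed

lemma fpb_ball:
  assumes "fpl L" "fpb (\<lambda>z. p (left z) (right z))"
  shows "fpb (\<lambda>e. \<forall>y\<in>set (L e). p e y)"
proof -
  have "fpb (\<lambda>e. tol (filter (\<lambda>y. \<not> p e y) (L e)) = Leaf)"
    by (intro fpb_eq_Leaf fp_tol fpl_filter assms fpb_not)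
  then show ?thesis by (simp add: filter_empty_conv)
qed

lemma fpb_bex:
  assumes "fpl L" "fpb (\<lambda>z. p (left z) (right z))"
  shows "fpb (\<lambda>e. \<exists>y\<in>set (L e). p e y)"
  using fpb_not[OF fpb_ball[OF assms(1) fpb_not[OF assms(2)]]] by simp

lemma fpb_all_less: "(\<And>r. fpb (P r)) \<Longrightarrow> fpb (\<lambda>e. \<forall>r<(n::nat). P r e)"
proof (induction n)
  case (Suc n)
  have "(\<lambda>e. \<forall>r<Suc n. P r e) = (\<lambda>e. P n e \<and> (\<forall>r<n. P r e))"
    by (auto simp: less_Suc_eq)
  then show ?case using Suc fpb_conj by simp
qed (simp add: fpb_const)

text \<open>Iterating \<open>right\<close> as often as a list is long is truncated unary subtraction
  and, followed by \<open>left\<close>, indexing. Comparison of numbers and access to gates both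
  rest on it.\<close>

lemma fp_funpow_right:
  assumes "fp X" "fpl L"
  shows "fp (\<lambda>e. (right ^^ length (L e)) (X e))"
proof -
  have f: "foldl (\<lambda>acc y. right acc) x xs = (right ^^ length xs) x" for x and xs :: "tree list"
    by (induction xs arbitrary: x) (auto simp: funpow_swap1)
  have b: "nodes ((right ^^ n) x) \<le> nodes x" for n x
    by (induction n) (auto intro: le_trans nodes_right)
  have "fp (\<lambda>e. foldl (\<lambda>acc y. right acc) (X e) (L e))"
    by (rule fp_foldl[where M = "\<lambda>e. nodes (X e)"])
      (use assms in \<open>auto simp: f b intro!: fp_left fp_right fp_id fp_pb\<close>)
  then show ?thesis by (simp add: f)
qed

text \<open>Every tree stands for the number \<open>nat_of\<close> of it, so only some representative has to be computed.\<close>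

definition fpn :: "(tree \<Rightarrow> nat) \<Rightarrow> bool" where
  "fpn n \<longleftrightarrow> (\<exists>f. fp f \<and> (\<forall>e. nat_of (f e) = n e))"

lemma fpn_nat_of: "fp f \<Longrightarrow> fpn (\<lambda>e. nat_of (f e))"
  unfolding fpn_def by blast

lemma fpn_length: "fpl L \<Longrightarrow> fpn (\<lambda>e. length (L e))"
  using fpn_nat_of[of "\<lambda>e. tol (L e)"] by (simp add: fpl_def nat_of_def)

lemma nat_of_tree_of_nat [simp]: "nat_of (tree_of_nat n) = n"
  by (induction n) (auto simp: nat_of_def)

lemma nat_of_Leaf [simp]: "nat_of Leaf = 0"
  and nat_of_Node [simp]: "nat_of (Node a b) = Suc (nat_of b)"
  by (auto simp: nat_of_def)

lemma fpn_const: "fpn (\<lambda>e. n)"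
  using fpn_nat_of[OF fp_const[of "tree_of_nat n"]] by simp

lemma fpn_Suc: assumes "fpn n" shows "fpn (\<lambda>e. Suc (n e))"
proof -
  obtain f where f: "fp f" "\<And>e. nat_of (f e) = n e" using assms unfolding fpn_def by blast
  from fpn_nat_of[OF fp_Node[OF fp_const f(1)]] show ?thesis by (simp add: f(2))
qed

lemma nat_of_funpow_right: "nat_of ((right ^^ n) x) = nat_of x - n"
proof (induction n)
  case (Suc n)
  have "nat_of (right y) = nat_of y - 1" for y by (cases y) auto
  then show ?case using Suc by simp
qed simp

lemma nat_of_eq_0: "nat_of x = 0 \<longleftrightarrow> x = Leaf"
  by (cases x) auto

lemma fpb_le: assumes "fpn m" "fpn n" shows "fpb (\<lambda>e. m e \<le> n e)"
proof -
  obtain f where f: "fp f" "\<And>e. nat_of (f e) = m e" using assms unfolding fpn_def by blast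
  obtain g where g: "fp g" "\<And>e. nat_of (g e) = n e" using assms unfolding fpn_def by blast
  have "fpb (\<lambda>e. (right ^^ length (list_of (g e))) (f e) = Leaf)"
    by (intro fpb_eq_Leaf fp_funpow_right fpl_list_of f g)
  moreover have "(right ^^ length (list_of (g e))) (f e) = Leaf \<longleftrightarrow> m e \<le> n e" for e
    unfolding nat_of_eq_0[symmetric] nat_of_funpow_right using f(2)[of e] g(2)[of e]
    by (simp add: nat_of_def)
  ultimately show ?thesis by simp
qed

lemma fpb_less: "fpn m \<Longrightarrow> fpn n \<Longrightarrow> fpb (\<lambda>e. m e < n e)"
  using fpb_not[OF fpb_le[of n m]] by (simp add: not_le)

lemma fpb_nat_eq: "fpn m \<Longrightarrow> fpn n \<Longrightarrow> fpb (\<lambda>e. m e = n e)"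
  using fpb_conj[OF fpb_le[of n m] fpb_le[of m n]] by (simp add: eq_iff conj_commute)

text \<open>The lengths of these nonempty suffixes run from \<open>nat_of\<close> of the tree down
  to 1. Bounded quantification over numbers is programmed by running through them.\<close>

fun suffs :: "tree \<Rightarrow> tree list" where
  "suffs Leaf = []"
| "suffs (Node a b) = Node a b # suffs b"

lemma fpl_suffs: assumes "fp f" shows "fpl (\<lambda>e. suffs (f e))"
proof -
  \<comment> \<open>The state holds the suffix still to be traversed and the suffixes collected so
    far, last first. The list element \<open>y\<close> merely counts rounds.\<close>
  define st where "st z y = Node (right (left z)) (Node (left z) (right z))" for z and y :: tree
  have fold: "j \<le> length (list_of t) \<Longrightarrow> foldl st (Node t a) (take j (list_of t)) =
      Node ((right ^^ j) t) (tol (rev (take j (suffs t)) @ list_of a))" for j t a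
  proof (induction t arbitrary: a j)
    case (Node t1 t2)
    show ?case
    proof (cases j)
      case (Suc i)
      then show ?thesis using Node(2)[of i "Node (Node t1 t2) a"] Node.prems
        by (simp add: st_def funpow_swap1)
    qed simp
  qed simp
  have ls: "length (suffs t) = length (list_of t)" for t by (induction t) auto
  have fr: "(right ^^ length (list_of t)) t = Leaf" for t
    unfolding nat_of_eq_0[symmetric] nat_of_funpow_right by (simp add: nat_of_def)
  have e: "foldl st (Node t Leaf) (list_of t) = Node Leaf (tol (rev (suffs t)))" for t
    using fold[of "length (list_of t)" t Leaf] by (simp add: ls fr)
  have sm: "nodes (tol (rev (take j (suffs t)))) \<le> 1 + length (take j (suffs t)) * (1 + nodes t)" for j t
  proof -
    have el: "s \<in> set (suffs t) \<Longrightarrow> nodes s \<le> nodes t" for s t by (induction t) auto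
    have "set xs \<subseteq> set (suffs t) \<Longrightarrow> nodes (tol xs) \<le> 1 + length xs * (1 + nodes t)" for xs
      by (induction xs) (auto dest!: el)
    from this[of "rev (take j (suffs t))"] show ?thesis by (simp add: set_take_subset)
  qed
  have b: "nodes (foldl st (Node t Leaf) (take j (list_of t))) \<le> nodes t + 2 + nodes t * (1 + nodes t)" for t j
  proof -
    define i where "i = min j (length (list_of t))"
    have i: "take j (list_of t) = take i (list_of t)" "i \<le> length (list_of t)"
      unfolding i_def by (auto simp: min_def)
    have "nodes ((right ^^ i) t) \<le> nodes t"
      by (induction i) (auto intro: le_trans nodes_right)
    moreover have "length (take i (suffs t)) * (1 + nodes t) \<le> nodes t * (1 + nodes t)"
      using i(2) length_nodes[of "list_of t"] by (intro mult_right_mono) (auto simp: ls)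
    ultimately show ?thesis using fold[OF i(2), of Leaf] sm[of i t] i(1) by simp
  qed
  have "fp (\<lambda>e. foldl st (Node (f e) Leaf) (list_of (f e)))"
    unfolding st_def
    by (rule fp_foldl[OF _ _ _ _ b[unfolded st_def]])
      (intro fpl_list_of fp_Node fp_const fp_left fp_right fp_id pb_add pb_mult pb_const fp_pb assms)+
  then have "fpl (\<lambda>e. rev (suffs (f e)))"
    unfolding e fpl_def by (rule fp_right[where f = "\<lambda>e. Node Leaf (tol (rev (suffs (f e))))", simplified])
  from fpl_rev[OF this] show ?thesis by simp
qed

section \<open>Circuits of weft one and bounded depth\<close>

text \<open>The depth and weft conditions quantify over all paths. These recursive forms can be
  tested by \<open>d\<close> nested loops. Having no predecessors means being an input in a
  well-formed circuit.\<close>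

primrec small_le :: "(nat \<Rightarrow> gate) \<Rightarrow> nat \<Rightarrow> nat \<Rightarrow> bool" where
  "small_le G 0 i \<longleftrightarrow> preds (G i) = []"
| "small_le G (Suc d) i \<longleftrightarrow> length (preds (G i)) \<le> 2 \<and> (\<forall>j\<in>set (preds (G i)). small_le G d j)"

primrec weft1_le :: "(nat \<Rightarrow> gate) \<Rightarrow> nat \<Rightarrow> nat \<Rightarrow> bool" where
  "weft1_le G 0 i \<longleftrightarrow> preds (G i) = []"
| "weft1_le G (Suc d) i \<longleftrightarrow>
    (if 2 < length (preds (G i)) then \<forall>j\<in>set (preds (G i)). small_le G d j
     else \<forall>j\<in>set (preds (G i)). weft1_le G d j)"

lemma small_le_imp_weft1_le: "small_le G d i \<Longrightarrow> weft1_le G d i"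
  by (induction d arbitrary: i) auto

text \<open>
  \<open>K v b\<close> means that input \<open>v\<close> is known to have value \<open>b\<close>. Small gates are evaluated in Kleene's
  three-valued logic; a large conjunction is taken to be true, and a large disjunction to be false,
  unless a known predecessor refutes this.
\<close>

primrec known :: "(nat \<Rightarrow> gate) \<Rightarrow> (nat \<Rightarrow> bool \<Rightarrow> bool) \<Rightarrow> nat \<Rightarrow> bool \<Rightarrow> nat \<Rightarrow> bool" where
  "known G K 0 b i \<longleftrightarrow> K i b"
| "known G K (Suc d) b i \<longleftrightarrow>
    (case G i of
      Input \<Rightarrow> K i b
    | Neg j \<Rightarrow> known G K d (\<not> b) j
    | Conj js \<Rightarrow>
        if b then if 2 < length js then \<not> (\<exists>j\<in>set js. known G K d False j) else \<forall>j\<in>set js. known G K d True j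
        else \<exists>j\<in>set js. known G K d False j
    | Disj js \<Rightarrow>
        if b then \<exists>j\<in>set js. known G K d True j
        else if 2 < length js then \<not> (\<exists>j\<in>set js. known G K d True j) else \<forall>j\<in>set js. known G K d False j)"

section \<open>Depth and weft conditions on paths in recursive form\<close>

context
  fixes C :: circuit and G :: "nat \<Rightarrow> gate"
  assumes wf: "wf_circuit C"
    and G: "\<And>i. i < length C \<Longrightarrow> G i = C ! i"
begin

lemma preds_less: "i < length C \<Longrightarrow> j \<in> set (preds (G i)) \<Longrightarrow> j < i"
  using wf G unfolding wf_circuit_def by simp

lemma preds_less_length: "i < length C \<Longrightarrow> j \<in> set (preds (G i)) \<Longrightarrow> j < length C"
  using preds_less by fastforce

lemma preds_Nil: "i < length C \<Longrightarrow> preds (G i) = [] \<longleftrightarrow> G i = Input"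
  using wf G unfolding wf_circuit_def by (cases "G i") force+

lemma gate_val_wf:
  assumes "i < length C"
  shows "gate_val C S i \<longleftrightarrow>
    (case G i of
      Input \<Rightarrow> i \<in> S
    | Neg j \<Rightarrow> \<not> gate_val C S j
    | Conj js \<Rightarrow> \<forall>j\<in>set js. gate_val C S j
    | Disj js \<Rightarrow> \<exists>j\<in>set js. gate_val C S j)"
  using preds_less[OF assms] G[OF assms, symmetric]
  by (subst gate_val.simps) (auto split: gate.split)

text \<open>This is \<open>io_path\<close> with an arbitrary end point. That all positions are in
  range is not demanded but follows, see \<open>path_to_less\<close>.\<close>

definition path_to :: "nat \<Rightarrow> nat list \<Rightarrow> bool" where
  "path_to i p \<longleftrightarrow> p \<noteq> [] \<and> hd p \<in> inputs C \<and> last p = i \<and>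
    successively (\<lambda>i j. i \<in> set (preds (C ! j))) p"

lemma path_to_iff:
  assumes "i < length C"
  shows "path_to i p \<longleftrightarrow>
    p = [i] \<and> G i = Input \<or> (\<exists>j q. j \<in> set (preds (G i)) \<and> path_to j q \<and> p = q @ [i])"
proof (cases p rule: rev_cases)
  case (snoc q x)
  show ?thesis
  proof (cases "q = []")
    case True
    then show ?thesis using assms G[OF assms] snoc by (auto simp: path_to_def inputs_def)
  next
    case False
    then show ?thesis using assms G[OF assms] snoc
      by (auto simp: path_to_def successively_append_iff)
  qed
qed (auto simp: path_to_def)

lemma path_to_less: "path_to i p \<Longrightarrow> i < length C \<Longrightarrow> set p \<subseteq> {..<length C}"
proof (induction p arbitrary: i rule: rev_induct)
  case (snoc x p)
  show ?case
    using snoc.prems path_to_iff[OF snoc.prems(2), of "p @ [x]"] snoc.IH preds_less_length by force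
qed simp

text \<open>The arity condition rules out gates without predecessors other than inputs, so going
  backwards always ends in an input. Thus a condition on all paths to a gate is never
  vacuous.\<close>

lemma path_to_exists: "i < length C \<Longrightarrow> \<exists>p. path_to i p"
proof (induction i rule: less_induct)
  case (less i)
  show ?case
  proof (cases "G i = Input")
    case True
    then show ?thesis using path_to_iff[OF less.prems] by blast
  next
    case False
    then obtain j where "j \<in> set (preds (G i))"
      using preds_Nil[OF less.prems] by (cases "preds (G i)") auto
    then show ?thesis
      using less.IH[of j] preds_less[OF less.prems] preds_less_length[OF less.prems]
        path_to_iff[OF less.prems] by metis
  qed
qed

abbreviation large :: "nat list \<Rightarrow> nat" where
  "large p \<equiv> length (filter (\<lambda>i. 2 < length (preds (C ! i))) p)"

text \<open>Removing the last gate of a path costs one unit of depth, and one unit of weft if that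
  gate is large. Both recursive tests follow from this step, with \<open>t\<close> equal to 0 and
  1.\<close>

lemma path_bounds_iff:
  assumes i: "i < length C"
  shows "(\<forall>p. path_to i p \<longrightarrow> length p - 1 \<le> d \<and> large p \<le> t) \<longleftrightarrow>
    (if preds (G i) = [] then True else
      0 < d \<and> (\<forall>j\<in>set (preds (G i)). \<forall>p. path_to j p \<longrightarrow>
        length p - 1 \<le> d - 1 \<and> large p + (if 2 < length (preds (G i)) then 1 else 0) \<le> t))"
proof (cases "preds (G i) = []")
  case True
  then have [simp]: "preds (C ! i) = []" using G[OF i] by simp
  show ?thesis using True path_to_iff[OF i] by auto
next
  case False
  have ne: "p \<noteq> []" if "path_to j p" for j p using that by (simp add: path_to_def)
  have "path_to i p \<longleftrightarrow> (\<exists>j q. j \<in> set (preds (G i)) \<and> path_to j q \<and> p = q @ [i])" for p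
    using path_to_iff[OF i, of p] False preds_Nil[OF i] by blast
  moreover have "(\<forall>p. (\<exists>j q. j \<in> A \<and> R j q \<and> p = f q) \<longrightarrow> P p) \<longleftrightarrow> (\<forall>j\<in>A. \<forall>q. R j q \<longrightarrow> P (f q))"
    for A :: "nat set" and R and f :: "nat list \<Rightarrow> nat list" and P
    by blast
  ultimately have "(\<forall>p. path_to i p \<longrightarrow> length p - 1 \<le> d \<and> large p \<le> t) \<longleftrightarrow>
     (\<forall>j\<in>set (preds (G i)). \<forall>q. path_to j q \<longrightarrow> length (q @ [i]) - 1 \<le> d \<and> large (q @ [i]) \<le> t)"
    by simp
  also have "\<dots> \<longleftrightarrow> (\<forall>j\<in>set (preds (G i)). \<forall>q. path_to j q \<longrightarrow> 0 < d \<and> length q - 1 \<le> d - 1 \<and>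
     large q + (if 2 < length (preds (G i)) then 1 else 0) \<le> t)"
  proof (intro ball_cong all_cong1 imp_cong refl)
    fix j q assume "path_to j q"
    then have "length q > 0" using ne by simp
    then show "length (q @ [i]) - 1 \<le> d \<and> large (q @ [i]) \<le> t \<longleftrightarrow>
        0 < d \<and> length q - 1 \<le> d - 1 \<and> large q + (if 2 < length (preds (G i)) then 1 else 0) \<le> t"
      using G[OF i] by (cases d) (auto simp: Suc_le_eq)
  qed
  also have "\<dots> \<longleftrightarrow> 0 < d \<and> (\<forall>j\<in>set (preds (G i)). \<forall>p. path_to j p \<longrightarrow>
        length p - 1 \<le> d - 1 \<and> large p + (if 2 < length (preds (G i)) then 1 else 0) \<le> t)"
  proof -
    \<comment> \<open>The condition \<open>0 < d\<close> can leave the quantifiers only because some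
      path does reach a predecessor.\<close>
    obtain j where "j \<in> set (preds (G i))" using False by (cases "preds (G i)") auto
    then show ?thesis using path_to_exists[OF preds_less_length[OF i]] by blast
  qed
  finally show ?thesis using False by simp
qed

lemma small_le_iff:
  "i < length C \<Longrightarrow> small_le G d i \<longleftrightarrow> (\<forall>p. path_to i p \<longrightarrow> length p - 1 \<le> d \<and> large p \<le> 0)"
proof (induction d arbitrary: i)
  case (Suc d)
  have "small_le G (Suc d) i \<longleftrightarrow> length (preds (G i)) \<le> 2 \<and>
      (\<forall>j\<in>set (preds (G i)). \<forall>p. path_to j p \<longrightarrow> length p - 1 \<le> d \<and> large p \<le> 0)"
    using Suc.IH[OF preds_less_length[OF Suc.prems]] by simp
  also have "\<dots> \<longleftrightarrow> (\<forall>p. path_to i p \<longrightarrow> length p - 1 \<le> Suc d \<and> large p \<le> 0)"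
  proof (cases "preds (G i) = []")
    case False
    then obtain j where "j \<in> set (preds (G i))" by (cases "preds (G i)") auto
    then show ?thesis unfolding path_bounds_iff[OF Suc.prems]
      using path_to_exists[OF preds_less_length[OF Suc.prems]] False by (simp add: not_less) blast
  next
    case True
    then show ?thesis unfolding path_bounds_iff[OF Suc.prems] by simp
  qed
  finally show ?case .
qed (subst path_bounds_iff; simp)

lemma weft1_le_iff:
  "i < length C \<Longrightarrow> weft1_le G d i \<longleftrightarrow> (\<forall>p. path_to i p \<longrightarrow> length p - 1 \<le> d \<and> large p \<le> 1)"
proof (induction d arbitrary: i)
  case (Suc d)
  have "weft1_le G (Suc d) i \<longleftrightarrow> (\<forall>j\<in>set (preds (G i)). \<forall>p. path_to j p \<longrightarrow>
      length p - 1 \<le> d \<and> large p + (if 2 < length (preds (G i)) then 1 else 0) \<le> 1)"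
    using Suc.IH[OF preds_less_length[OF Suc.prems]] small_le_iff[OF preds_less_length[OF Suc.prems], of _ d]
    by simp
  then show ?case unfolding path_bounds_iff[OF Suc.prems] by simp
qed (subst path_bounds_iff; simp)

lemma weft1_le_correct: "weft1_le G d (length C - 1) \<longleftrightarrow> weft_le 1 C \<and> depth_le d C"
proof -
  have n: "length C - 1 < length C" using wf by (simp add: wf_circuit_def)
  have "io_path C p \<longleftrightarrow> path_to (length C - 1) p" for p
    using path_to_less[OF _ n] by (auto simp: io_path_def path_to_def)
  then show ?thesis unfolding weft1_le_iff[OF n] weft_le_def depth_le_def by blast
qed

section \<open>Evaluation from partial knowledge of a set of inputs\<close>

context
  fixes S :: "nat set" and cov :: "nat \<Rightarrow> nat \<Rightarrow> bool" and M :: "nat set"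
  assumes cov: "\<And>v. v < length C \<Longrightarrow> \<exists>s\<in>M. cov s v"
begin

text \<open>Here \<open>cov s v\<close> says that index \<open>s\<close> decides the status of input
  \<open>v\<close>. The indices, later the slots of tokens, stay abstract: all that matters is that
  \<open>M\<close> decides every position and that the information agrees with
  \<open>S\<close>.\<close>

abbreviation know :: "nat set \<Rightarrow> nat \<Rightarrow> bool \<Rightarrow> bool" where
  "know B v b \<equiv> \<exists>s\<in>B. cov s v \<and> (v \<in> S \<longleftrightarrow> b)"

text \<open>Without large gates no default is ever applied, and Kleene evaluation from correct
  information is correct, however little is known.\<close>

lemma known_sound:
  "small_le G d i \<Longrightarrow> i < length C \<Longrightarrow> known G (know B) d b i \<Longrightarrow> gate_val C S i \<longleftrightarrow> b"
proof (induction d arbitrary: i b)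
  case 0
  then show ?case by (auto simp: preds_Nil gate_val_wf)
next
  case (Suc d)
  have IH: "j \<in> set (preds (G i)) \<Longrightarrow> known G (know B) d b j \<Longrightarrow> gate_val C S j \<longleftrightarrow> b" for j b
    using Suc preds_less_length by auto
  show ?case using Suc.prems IH
    by (cases "G i"; cases b) (fastforce simp: gate_val_wf)+
qed

text \<open>The certificate must work for all supersets, since \<open>known\<close> is not monotone.
  A small gate takes the union of the certificates of its at most two predecessors. A large gate
  with its default value needs none, as by \<open>known_sound\<close> nothing can refute it; with
  the other value it needs the certificate of one predecessor that refutes the default.\<close>

lemma known_complete:
  "weft1_le G d i \<Longrightarrow> i < length C \<Longrightarrow> \<exists>A\<subseteq>M. finite A \<and> card A \<le> 2 ^ d \<and>
    (\<forall>B. A \<subseteq> B \<longrightarrow> (\<forall>b. known G (know B) d b i \<longleftrightarrow> (gate_val C S i \<longleftrightarrow> b)))"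
proof (induction d arbitrary: i)
  case 0
  then obtain s where s: "s \<in> M" "cov s i" using cov by blast
  have "known G (know B) 0 b i \<longleftrightarrow> (gate_val C S i \<longleftrightarrow> b)" if "{s} \<subseteq> B" for B b
    using s that 0 by (auto simp: preds_Nil gate_val_wf)
  then show ?case using s by (intro exI[of _ "{s}"]) auto
next
  case (Suc d)
  note i = Suc.prems(2)
  let ?P = "\<lambda>A B. A \<subseteq> B \<longrightarrow> (\<forall>b. known G (know B) (Suc d) b i \<longleftrightarrow> (gate_val C S i \<longleftrightarrow> b))"
  consider (input) "G i = Input" | (small) "G i \<noteq> Input" "length (preds (G i)) \<le> 2"
    | (conj) js where "G i = Conj js" "2 < length js" | (disj) js where "G i = Disj js" "2 < length js"
    by (cases "G i") (auto simp: not_less[symmetric])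
  then have "\<exists>A\<subseteq>M. finite A \<and> card A \<le> 2 ^ Suc d \<and> (\<forall>B. ?P A B)"
  proof cases
    case input
    then obtain s where s: "s \<in> M" "cov s i" using cov i by blast
    then have "?P {s} B" for B
      using s i input by (auto simp: gate_val_wf)
    then show ?thesis using s by (intro exI[of _ "{s}"]) auto
  next
    case small
    define cert where "cert j A \<longleftrightarrow> A \<subseteq> M \<and> finite A \<and> card A \<le> 2 ^ d \<and>
        (\<forall>B. A \<subseteq> B \<longrightarrow> (\<forall>b. known G (know B) d b j \<longleftrightarrow> (gate_val C S j \<longleftrightarrow> b)))" for j A
    have "\<forall>j\<in>set (preds (G i)). \<exists>A. cert j A"
      using Suc small(2) preds_less_length[OF i] unfolding cert_def by auto
    from bchoice[OF this] obtain f where f: "\<And>j. j \<in> set (preds (G i)) \<Longrightarrow> cert j (f j)" by blast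
    define A where "A = (\<Union>j\<in>set (preds (G i)). f j)"
    have "card A \<le> (\<Sum>j\<in>set (preds (G i)). card (f j))"
      unfolding A_def by (rule card_UN_le) simp
    also have "\<dots> \<le> card (set (preds (G i))) * 2 ^ d"
      using sum_bounded_above[of "set (preds (G i))" "\<lambda>j. card (f j)" "2 ^ d"] f
      by (simp add: cert_def)
    also have "\<dots> \<le> 2 * 2 ^ d"
      using small(2) card_length[of "preds (G i)"] by (intro mult_right_mono) auto
    finally have "card A \<le> 2 ^ Suc d" by simp
    moreover have "?P A B" for B
    proof (intro impI allI)
      fix b assume "A \<subseteq> B"
      then have "known G (know B) d b j \<longleftrightarrow> (gate_val C S j \<longleftrightarrow> b)" if "j \<in> set (preds (G i))" for j b
        using f[OF that] that unfolding A_def cert_def by blast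
      then show "known G (know B) (Suc d) b i \<longleftrightarrow> (gate_val C S i \<longleftrightarrow> b)"
        using small gate_val_wf[OF i] by (cases "G i") (simp_all del: Bex_def, blast+)
    qed
    moreover have "A \<subseteq> M" "finite A" using f unfolding A_def cert_def by blast+
    ultimately show ?thesis by blast
  next
    case conj
    have sm: "small_le G d j" "j < length C" if "j \<in> set js" for j
      using Suc.prems conj that preds_less_length[OF i] by auto
    show ?thesis
    proof (cases "gate_val C S i")
      case True
      \<comment> \<open>Predecessors of a large gate are small, so by soundness no \<open>B\<close>
        whatsoever refutes the default, and the empty certificate suffices.\<close>
      then have "\<not> known G (know B) d False j" if "j \<in> set js" for j B
        using known_sound[OF sm[OF that], of B False] that conj i by (auto simp: gate_val_wf)
      then have "?P {} B" for B using conj True by auto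
      then show ?thesis by (intro exI[of _ "{}"]) auto
    next
      case False
      then obtain j where j: "j \<in> set js" "\<not> gate_val C S j" using conj i by (auto simp: gate_val_wf)
      obtain A where A: "A \<subseteq> M" "finite A" "card A \<le> 2 ^ d"
        "\<forall>B. A \<subseteq> B \<longrightarrow> (\<forall>b. known G (know B) d b j \<longleftrightarrow> (gate_val C S j \<longleftrightarrow> b))"
        using Suc.IH[OF small_le_imp_weft1_le[OF sm(1)[OF j(1)]] sm(2)[OF j(1)]] by (elim exE conjE)
      have P: "?P A B" for B using A(4)[rule_format, of B False] j conj False by auto
      have "card A \<le> 2 ^ Suc d" using A(3) by simp
      then show ?thesis using A(1,2) P by blast
    qed
  next
    case disj
    have sm: "small_le G d j" "j < length C" if "j \<in> set js" for j
      using Suc.prems disj that preds_less_length[OF i] by auto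
    show ?thesis
    proof (cases "gate_val C S i")
      case False
      then have "\<not> known G (know B) d True j" if "j \<in> set js" for j B
        using known_sound[OF sm[OF that], of B True] that disj i by (auto simp: gate_val_wf)
      then have "?P {} B" for B using disj False by auto
      then show ?thesis by (intro exI[of _ "{}"]) auto
    next
      case True
      then obtain j where j: "j \<in> set js" "gate_val C S j" using disj i by (auto simp: gate_val_wf)
      obtain A where A: "A \<subseteq> M" "finite A" "card A \<le> 2 ^ d"
        "\<forall>B. A \<subseteq> B \<longrightarrow> (\<forall>b. known G (know B) d b j \<longleftrightarrow> (gate_val C S j \<longleftrightarrow> b))"
        using Suc.IH[OF small_le_imp_weft1_le[OF sm(1)[OF j(1)]] sm(2)[OF j(1)]] by (elim exE conjE)
      have P: "?P A B" for B using A(4)[rule_format, of B True] j disj True by auto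
      have "card A \<le> 2 ^ Suc d" using A(3) by simp
      then show ?thesis using A(1,2) P by blast
    qed
  qed
  then show ?case .
qed

end

end

section \<open>Weighted satisfiability as a clique problem\<close>

text \<open>
  A set of inputs \<open>s\<^sub>1 < \<dots> < s\<^sub>k\<close> is cut into tokens \<open>(i, s\<^sub>i, s\<^sub>i\<^sub>+\<^sub>1)\<close> with \<open>s\<^sub>0 = 0\<close> and \<open>s\<^sub>k\<^sub>+\<^sub>1 = n\<close>.
  The token in slot \<open>i\<close> fixes all inputs in \<open>[s\<^sub>i, s\<^sub>i\<^sub>+\<^sub>1)\<close>: only \<open>s\<^sub>i\<close> itself belongs to the set, and
  only if \<open>i > 0\<close>. The tokens \<open>(k + 1, n, n)\<close> and \<open>(k + 2, n, n)\<close> carry no information; they make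
  the number of slots at least 3.
\<close>

type_synonym token = "nat \<times> nat \<times> nat"

definition valid_token :: "(nat \<Rightarrow> gate) \<Rightarrow> nat \<Rightarrow> nat \<Rightarrow> token \<Rightarrow> bool" where
  "valid_token G n k t \<longleftrightarrow> (case t of (i, a, b) \<Rightarrow>
    i \<le> k + 2 \<and> a \<le> b \<and> b \<le> n \<and> (i = 0 \<longrightarrow> a = 0) \<and> (0 < i \<longrightarrow> i \<le> k \<longrightarrow> a < b \<and> G a = Input) \<and>
    (k \<le> i \<longrightarrow> b = n) \<and> (k < i \<longrightarrow> a = n))"

text \<open>Each condition concerns only two tokens, of equal or neighbouring slots. Hence pairwise
  compatibility, which is all that a clique can express, makes a token set meeting all slots into a
  single chain.\<close>

definition compatible :: "token \<Rightarrow> token \<Rightarrow> bool" where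
  "compatible t t' \<longleftrightarrow> (case (t, t') of ((i, a, b), (j, c, d)) \<Rightarrow>
    (i = j \<longrightarrow> a = c \<and> b = d) \<and> (j = Suc i \<longrightarrow> b = c) \<and> (i = Suc j \<longrightarrow> d = a))"

definition told :: "token set \<Rightarrow> nat \<Rightarrow> bool \<Rightarrow> bool" where
  "told T v b \<longleftrightarrow> (\<exists>(i, l, r)\<in>T. l \<le> v \<and> v < r \<and> ((0 < i \<and> l = v) \<longleftrightarrow> b))"

text \<open>
  The first \<open>q\<close> tokens of a vertex are shared by the whole clique: they contain a certificate for the
  large gates whose value differs from the default. The remaining ones run through all \<open>q\<close>-tuples of
  slots, so every certificate against the default values occurs among them.
\<close>

definition vertices :: "(nat \<Rightarrow> gate) \<Rightarrow> nat \<Rightarrow> nat \<Rightarrow> nat \<Rightarrow> nat \<Rightarrow> token list set" where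
  "vertices G n k d q = {T. length T = 2 * q \<and> (\<forall>t\<in>set T. valid_token G n k t) \<and>
    (\<forall>t\<in>set T. \<forall>t'\<in>set T. compatible t t') \<and> known G (told (set T)) d True (n - 1)}"

text \<open>The lists of slots, not just the tokens, have to differ. As the first halves agree in
  their slots, clique members then differ in the slots of their second halves, so a clique of
  maximal size runs through all slot tuples.\<close>

definition adjacent :: "nat \<Rightarrow> token list \<Rightarrow> token list \<Rightarrow> bool" where
  "adjacent q T T' \<longleftrightarrow> map fst (take q T) = map fst (take q T') \<and> map fst T \<noteq> map fst T' \<and>
    (\<forall>t\<in>set T. \<forall>t'\<in>set T'. compatible t t')"

lemma compatible_sym: "compatible t t' \<longleftrightarrow> compatible t' t"
  by (auto simp: compatible_def split: prod.splits)

section \<open>Chains of tokens and the input sets that they describe\<close>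

context
  fixes C :: circuit and G :: "nat \<Rightarrow> gate" and \<alpha> \<beta> :: "nat \<Rightarrow> nat" and k :: nat and S :: "nat set"
  assumes wf: "wf_circuit C" and G: "\<And>i. i < length C \<Longrightarrow> G i = C ! i"
    and valid: "\<And>i. i \<le> k + 2 \<Longrightarrow> valid_token G (length C) k (i, \<alpha> i, \<beta> i)"
    and chain: "\<And>i. i \<le> k + 1 \<Longrightarrow> \<beta> i = \<alpha> (Suc i)"
    and S: "S = \<alpha> ` {1..k}"
begin

lemma chain_le: "i \<le> j \<Longrightarrow> j \<le> k + 2 \<Longrightarrow> \<alpha> i \<le> \<alpha> j"
proof (induction j rule: dec_induct)
  case (step j)
  have "\<alpha> j \<le> \<beta> j" using valid[of j] step by (simp add: valid_token_def)
  then show ?case using step chain[of j] by simp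
qed simp

lemma chain_less: "0 < i \<Longrightarrow> i < j \<Longrightarrow> j \<le> k \<Longrightarrow> \<alpha> i < \<alpha> j"
  using valid[of i] chain[of i] chain_le[of "Suc i" j] by (simp add: valid_token_def)

lemma chain_inputs: "S \<subseteq> inputs C"
proof
  fix v assume "v \<in> S"
  then obtain i where "v = \<alpha> i" "0 < i" "i \<le> k" unfolding S by auto
  then show "v \<in> inputs C" using valid[of i] G[of v] by (auto simp: valid_token_def inputs_def)
qed

lemma chain_card: "card S = k"
proof -
  have "inj_on \<alpha> {1..k}"
    by (rule linorder_inj_onI) (auto dest: chain_less[rotated])
  then show ?thesis by (simp add: S card_image)
qed

lemma chain_covers:
  assumes "v < length C"
  shows "\<exists>i\<in>{..k + 2}. \<alpha> i \<le> v \<and> v < \<beta> i"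
proof -
  have k: "v < \<beta> k" using valid[of k] assms by (simp add: valid_token_def)
  define i where "i = (LEAST i. v < \<beta> i)"
  have i: "v < \<beta> i" "i \<le> k" unfolding i_def using k by (auto intro: LeastI Least_le)
  have "\<alpha> i \<le> v"
  proof (cases i)
    case 0
    then show ?thesis using valid[of 0] by (simp add: valid_token_def)
  next
    case (Suc j)
    then have "\<not> v < \<beta> j" unfolding i_def using not_less_Least by (metis lessI)
    then show ?thesis using chain[of j] Suc i by simp
  qed
  then show ?thesis using i by auto
qed

text \<open>The intervals of a chain are disjoint. If \<open>v\<close> were \<alpha> of some
  \<open>j\<close> other than \<open>i\<close>, then \<open>i < j\<close> would put \<open>v\<close>
  at or beyond the end of interval \<open>i\<close>, and \<open>j < i\<close> would put it before
  its start.\<close>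

lemma chain_status:
  assumes i: "i \<le> k + 2" "\<alpha> i \<le> v" "v < \<beta> i"
  shows "v \<in> S \<longleftrightarrow> 0 < i \<and> \<alpha> i = v"
proof
  assume "v \<in> S"
  then obtain j where j: "v = \<alpha> j" "0 < j" "j \<le> k" unfolding S by auto
  have "\<not> i < j"
    using chain[of i] chain_le[of "Suc i" j] i j by auto
  moreover have "\<not> j < i"
    using valid[of j] chain[of j] chain_le[of "Suc j" i] i j by (auto simp: valid_token_def)
  ultimately show "0 < i \<and> \<alpha> i = v" using j by auto
next
  assume *: "0 < i \<and> \<alpha> i = v"
  then have "i \<le> k" using valid[of i] i by (auto simp: valid_token_def)
  then show "v \<in> S" unfolding S using * by auto
qed

text \<open>This is \<open>known_complete\<close> with the slots as indices. The certificate is a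
  set of slots that does not depend on \<open>T\<close>, so it can be looked for among slot
  tuples.\<close>

lemma chain_known:
  assumes "weft1_le G d (length C - 1)"
  shows "\<exists>A\<subseteq>{..k + 2}. card A \<le> 2 ^ d \<and> (\<forall>T. T \<subseteq> (\<lambda>i. (i, \<alpha> i, \<beta> i)) ` {..k + 2} \<longrightarrow> A \<subseteq> fst ` T \<longrightarrow>
    (known G (told T) d True (length C - 1) \<longleftrightarrow> satisfies S C))"
proof -
  let ?cov = "\<lambda>i v. \<alpha> i \<le> v \<and> v < \<beta> i"
  have n: "length C - 1 < length C" using wf by (simp add: wf_circuit_def)
  have "\<exists>A\<subseteq>{..k + 2}. finite A \<and> card A \<le> 2 ^ d \<and>
    (\<forall>B. A \<subseteq> B \<longrightarrow> (\<forall>b. known G (\<lambda>v b. \<exists>s\<in>B. ?cov s v \<and> (v \<in> S \<longleftrightarrow> b)) d b (length C - 1) \<longleftrightarrow>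
      (gate_val C S (length C - 1) \<longleftrightarrow> b)))"
    by (rule known_complete[where cov = ?cov, OF wf]; fact G chain_covers assms n)
  then obtain A where A: "A \<subseteq> {..k + 2}" "card A \<le> 2 ^ d"
    "\<forall>B. A \<subseteq> B \<longrightarrow> (\<forall>b. known G (\<lambda>v b. \<exists>s\<in>B. ?cov s v \<and> (v \<in> S \<longleftrightarrow> b)) d b (length C - 1) \<longleftrightarrow>
      (gate_val C S (length C - 1) \<longleftrightarrow> b))"
    by (elim exE conjE)
  have told: "told T = (\<lambda>v b. \<exists>s\<in>fst ` T. ?cov s v \<and> (v \<in> S \<longleftrightarrow> b))"
    if T: "T \<subseteq> (\<lambda>i. (i, \<alpha> i, \<beta> i)) ` {..k + 2}" for T
  proof (intro ext)
    fix v b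
    have "told T v b \<longleftrightarrow> (\<exists>t\<in>T. fst (snd t) \<le> v \<and> v < snd (snd t) \<and> ((0 < fst t \<and> fst (snd t) = v) \<longleftrightarrow> b))"
      by (auto simp: told_def case_prod_beta)
    also have "\<dots> \<longleftrightarrow> (\<exists>t\<in>T. ?cov (fst t) v \<and> (v \<in> S \<longleftrightarrow> b))"
    proof (rule bex_cong[OF refl])
      fix t assume "t \<in> T"
      then obtain i where "i \<le> k + 2" "t = (i, \<alpha> i, \<beta> i)" using T by auto
      then show "fst (snd t) \<le> v \<and> v < snd (snd t) \<and> ((0 < fst t \<and> fst (snd t) = v) \<longleftrightarrow> b) \<longleftrightarrow>
          ?cov (fst t) v \<and> (v \<in> S \<longleftrightarrow> b)"
        using chain_status[of i v] by auto
    qed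
    finally show "told T v b \<longleftrightarrow> (\<exists>s\<in>fst ` T. ?cov s v \<and> (v \<in> S \<longleftrightarrow> b))" by simp
  qed
  have "known G (told T) d True (length C - 1) \<longleftrightarrow> satisfies S C"
    if "T \<subseteq> (\<lambda>i. (i, \<alpha> i, \<beta> i)) ` {..k + 2}" "A \<subseteq> fst ` T" for T
    using A(3)[rule_format, OF that(2), of True] unfolding told[OF that(1)] satisfies_def by simp
  then show ?thesis using A(1,2) by blast
qed

end

lemma ex_list_of_set:
  assumes "finite M" "A \<subseteq> M" "card A \<le> q" "z \<in> M"
  shows "\<exists>xs. length xs = q \<and> A \<subseteq> set xs \<and> set xs \<subseteq> M"
proof -
  obtain ys where ys: "set ys = A" "distinct ys"
    using finite_distinct_list finite_subset assms by metis
  then have "length ys \<le> q" using assms(3) distinct_card by metis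
  then show ?thesis using ys assms by (intro exI[of _ "ys @ replicate (q - length ys) z"]) auto
qed

text \<open>From a clique: its size forces every slot tuple to occur as a second half, so its tokens
  form one chain, and the member whose second half contains the certificate evaluates correctly.
  From a satisfying set: the certificate is put into the shared half, so every member evaluates
  correctly.\<close>

lemma clique_iff_satisfiable:
  assumes wf: "wf_circuit C" and G: "\<And>i. i < length C \<Longrightarrow> G i = C ! i"
    and weft: "weft1_le G d (length C - 1)" and q: "q = 2 ^ d"
  shows "(\<exists>K \<subseteq> vertices G (length C) k d q. card K = (k + 3) ^ q \<and> (\<forall>T\<in>K. \<forall>T'\<in>K. T \<noteq> T' \<longrightarrow> adjacent q T T'))
    \<longleftrightarrow> (\<exists>S\<subseteq>inputs C. card S = k \<and> satisfies S C)"
proof -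
  define \<Sigma> where "\<Sigma> = {\<sigma>. set \<sigma> \<subseteq> {..k + 2} \<and> length \<sigma> = q}"
  have card\<Sigma>: "card \<Sigma> = (k + 3) ^ q" unfolding \<Sigma>_def
    using card_lists_length_eq[of "{..k + 2}" q] by (simp add: numeral_3_eq_3)
  have fin\<Sigma>: "finite \<Sigma>" unfolding \<Sigma>_def by (rule finite_lists_length_eq) simp
  let ?n = "length C"
  show ?thesis
  proof
    assume "\<exists>K \<subseteq> vertices G ?n k d q. card K = (k + 3) ^ q \<and> (\<forall>T\<in>K. \<forall>T'\<in>K. T \<noteq> T' \<longrightarrow> adjacent q T T')"
    then obtain K where K: "K \<subseteq> vertices G ?n k d q" "card K = (k + 3) ^ q"
      and adj: "\<And>T T'. T \<in> K \<Longrightarrow> T' \<in> K \<Longrightarrow> T \<noteq> T' \<Longrightarrow> adjacent q T T'" by blast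
    have len: "length T = 2 * q" if "T \<in> K" for T using that K(1) by (auto simp: vertices_def)
    have vt: "valid_token G ?n k t" if "T \<in> K" "t \<in> set T" for T t
      using that K(1) by (auto simp: vertices_def)
    have kn: "known G (told (set T)) d True (?n - 1)" if "T \<in> K" for T
      using that K(1) by (auto simp: vertices_def)
    let ?f = "\<lambda>T. map fst (drop q T)"
    have "inj_on ?f K"
    proof (rule inj_onI, rule ccontr)
      fix T T' assume "T \<in> K" "T' \<in> K" "?f T = ?f T'" "T \<noteq> T'"
      moreover from this have "map fst (take q T) = map fst (take q T')" "map fst T \<noteq> map fst T'"
        using adj unfolding adjacent_def by blast+
      ultimately show False by (metis append_take_drop_id map_append)
    qed
    moreover have "?f ` K \<subseteq> \<Sigma>"
      using vt len unfolding \<Sigma>_def by (fastforce simp: valid_token_def dest: in_set_dropD)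
    \<comment> \<open>An injection between finite sets of equal size is onto: this is where the
      exact clique size enters.\<close>
    ultimately have onto: "?f ` K = \<Sigma>"
      using card_subset_eq[OF fin\<Sigma>] card_image K(2) card\<Sigma> by metis
    define U where "U = (\<Union>T\<in>K. set T)"
    have comp: "compatible t t'" if t: "t \<in> U" "t' \<in> U" for t t'
    proof -
      obtain T T' where T: "T \<in> K" "T' \<in> K" "t \<in> set T" "t' \<in> set T'" using t unfolding U_def by blast
      show ?thesis
      proof (cases "T = T'")
        case True
        then show ?thesis using T K(1) by (auto simp: vertices_def)
      next
        case False
        then show ?thesis using adj T unfolding adjacent_def by blast
      qed
    qed
    have "\<forall>i. \<exists>ab. i \<le> k + 2 \<longrightarrow> (i, ab) \<in> U"
    proof (intro allI)
      fix i
      show "\<exists>ab. i \<le> k + 2 \<longrightarrow> (i, ab) \<in> U"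
      proof (cases "i \<le> k + 2")
        case True
        \<comment> \<open>The constant tuple provides a token for slot \<open>i\<close>, because
          \<open>q\<close> is positive.\<close>
        then have "replicate q i \<in> ?f ` K" unfolding onto \<Sigma>_def by auto
        then obtain T where T: "T \<in> K" "?f T = replicate q i" by auto
        then have "i \<in> fst ` set (drop q T)" using q by (metis (no_types) set_map in_set_replicate power_not_zero zero_neq_numeral)
        then obtain ab where "(i, ab) \<in> set T" by (auto dest: in_set_dropD)
        then show ?thesis using T unfolding U_def by blast
      qed simp
    qed
    from choice[OF this] obtain ab where ab: "\<And>i. i \<le> k + 2 \<Longrightarrow> (i, ab i) \<in> U" by blast
    define \<alpha> where "\<alpha> = fst \<circ> ab"
    define \<beta> where "\<beta> = snd \<circ> ab"
    have \<alpha>\<beta>: "(i, \<alpha> i, \<beta> i) \<in> U" if "i \<le> k + 2" for i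
      using ab[OF that] by (simp add: \<alpha>_def \<beta>_def)
    have U: "U \<subseteq> (\<lambda>i. (i, \<alpha> i, \<beta> i)) ` {..k + 2}"
    proof
      fix t assume t: "t \<in> U"
      obtain i a b where [simp]: "t = (i, a, b)" by (cases t)
      have "i \<le> k + 2" using t vt unfolding U_def by (fastforce simp: valid_token_def)
      then show "t \<in> (\<lambda>i. (i, \<alpha> i, \<beta> i)) ` {..k + 2}"
        using comp[OF t \<alpha>\<beta>[of i]] by (auto simp: compatible_def)
    qed
    have valid: "valid_token G ?n k (i, \<alpha> i, \<beta> i)" if "i \<le> k + 2" for i
      using \<alpha>\<beta>[OF that] vt unfolding U_def by blast
    have chain: "\<beta> i = \<alpha> (Suc i)" if "i \<le> k + 1" for i
      using comp[OF \<alpha>\<beta>[of i] \<alpha>\<beta>[of "Suc i"]] that by (simp add: compatible_def)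
    define S where "S = \<alpha> ` {1..k}"
    note * = wf G valid chain S_def
    have "\<exists>A\<subseteq>{..k + 2}. card A \<le> 2 ^ d \<and> (\<forall>T. T \<subseteq> (\<lambda>i. (i, \<alpha> i, \<beta> i)) ` {..k + 2} \<longrightarrow> A \<subseteq> fst ` T \<longrightarrow>
        (known G (told T) d True (?n - 1) \<longleftrightarrow> satisfies S C))"
      by (rule chain_known[OF wf]; fact *(2-) weft)
    then obtain A where A: "A \<subseteq> {..k + 2}" "card A \<le> q"
      "\<forall>T. T \<subseteq> (\<lambda>i. (i, \<alpha> i, \<beta> i)) ` {..k + 2} \<longrightarrow> A \<subseteq> fst ` T \<longrightarrow>
        (known G (told T) d True (?n - 1) \<longleftrightarrow> satisfies S C)"
      unfolding q by (elim exE conjE)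
    obtain xs where xs: "length xs = q" "A \<subseteq> set xs" "set xs \<subseteq> {..k + 2}"
      using ex_list_of_set[OF _ A(1,2), of 0] by auto
    \<comment> \<open>The certificate, padded to a \<open>q\<close>-tuple of slots, is the second
      half of some clique member. That this member is known to be true now means that the circuit is
      satisfied.\<close>
    then have "xs \<in> ?f ` K" unfolding onto \<Sigma>_def by blast
    then obtain T where T: "T \<in> K" "?f T = xs" by auto
    have "set xs \<subseteq> fst ` set T" using T(2) set_drop_subset[of q T] by force
    then have "satisfies S C"
      using A(3)[rule_format, of "set T"] kn[OF T(1)] U T(1) xs(2) unfolding U_def by blast
    then show "\<exists>S\<subseteq>inputs C. card S = k \<and> satisfies S C"
      using chain_inputs[of C G k \<alpha> \<beta>, OF *] chain_card[of C G k \<alpha> \<beta>, OF *] by blast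
  next
    assume "\<exists>S\<subseteq>inputs C. card S = k \<and> satisfies S C"
    then obtain S where S: "S \<subseteq> inputs C" "card S = k" "satisfies S C" by blast
    have "finite S" using S(1) finite_subset[of S "{..<?n}"] by (auto simp: inputs_def)
    define ss where "ss = sorted_list_of_set S"
    have ss: "set ss = S" "length ss = k" "sorted_wrt (<) ss"
      using \<open>finite S\<close> S(2) by (auto simp: ss_def)
    define \<alpha> where "\<alpha> i = (if i = 0 then 0 else if i \<le> k then ss ! (i - 1) else ?n)" for i
    define \<beta> where "\<beta> i = \<alpha> (Suc i)" for i
    have inp: "\<alpha> i \<in> inputs C" if "0 < i" "i \<le> k" for i
    proof -
      have "ss ! (i - 1) \<in> set ss" using that ss(2) by (intro nth_mem) simp
      then show ?thesis using that ss(1) S(1) by (auto simp: \<alpha>_def)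
    qed
    have le: "\<alpha> i \<le> ?n" for i
      using inp[of i] by (cases "0 < i \<and> i \<le> k") (auto simp: \<alpha>_def inputs_def)
    have lt: "\<alpha> i < \<alpha> (Suc i)" if "0 < i" "i \<le> k" for i
    proof (cases "i = k")
      case True
      then show ?thesis using inp[OF that] by (simp add: \<alpha>_def inputs_def)
    next
      case False
      then show ?thesis using sorted_wrt_nth_less[OF ss(3), of "i - 1" i] that ss(2)
        by (simp add: \<alpha>_def)
    qed
    have valid: "valid_token G ?n k (i, \<alpha> i, \<beta> i)" if "i \<le> k + 2" for i
      using that le[of "Suc i"] lt[of i] inp[of i] G[of "\<alpha> i"]
      by (auto simp: valid_token_def \<beta>_def inputs_def) (auto simp: \<alpha>_def)
    have SS: "S = \<alpha> ` {1..k}"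
    proof -
      have "S = (\<lambda>i. ss ! i) ` {0..<k}" using ss by (auto simp: set_conv_nth)
      also have "\<dots> = (\<lambda>i. ss ! (i - 1)) ` {1..k}"
      proof -
        have "{1..k} = Suc ` {0..<k}" by (simp add: image_Suc_atLeastLessThan atLeastLessThanSuc_atLeastAtMost)
        then show ?thesis by (simp only: image_image) simp
      qed
      also have "\<dots> = \<alpha> ` {1..k}" by (auto simp: \<alpha>_def)
      finally show ?thesis .
    qed
    have chain: "\<beta> i = \<alpha> (Suc i)" if "i \<le> k + 1" for i by (simp add: \<beta>_def)
    note * = wf G valid chain SS
    let ?t = "\<lambda>i. (i, \<alpha> i, \<beta> i)"
    have "\<exists>A\<subseteq>{..k + 2}. card A \<le> 2 ^ d \<and> (\<forall>T. T \<subseteq> ?t ` {..k + 2} \<longrightarrow> A \<subseteq> fst ` T \<longrightarrow>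
        (known G (told T) d True (?n - 1) \<longleftrightarrow> satisfies S C))"
      by (rule chain_known[OF wf]; fact *(2-) weft)
    then obtain A where A: "A \<subseteq> {..k + 2}" "card A \<le> q"
      "\<forall>T. T \<subseteq> ?t ` {..k + 2} \<longrightarrow> A \<subseteq> fst ` T \<longrightarrow>
        (known G (told T) d True (?n - 1) \<longleftrightarrow> satisfies S C)"
      unfolding q by (elim exE conjE)
    obtain xs where xs: "length xs = q" "A \<subseteq> set xs" "set xs \<subseteq> {..k + 2}"
      using ex_list_of_set[OF _ A(1,2), of 0] by auto
    \<comment> \<open>The shared half \<open>xs\<close> contains the certificate, while \<sigma>
      runs through all slot tuples.\<close>
    define K where "K = (\<lambda>\<sigma>. map ?t (xs @ \<sigma>)) ` \<Sigma>"
    have fst_t: "map fst (map ?t ys) = ys" for ys by (induction ys) auto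
    have comp: "compatible (?t i) (?t j)" for i j by (auto simp: compatible_def \<beta>_def)
    have "K \<subseteq> vertices G ?n k d q"
    proof
      fix T assume "T \<in> K"
      then obtain \<sigma> where \<sigma>: "\<sigma> \<in> \<Sigma>" "T = map ?t (xs @ \<sigma>)" unfolding K_def by blast
      have sub: "set (xs @ \<sigma>) \<subseteq> {..k + 2}" using \<sigma>(1) xs(3) by (auto simp: \<Sigma>_def)
      have "fst ` set T = set (xs @ \<sigma>)" unfolding \<sigma>(2) by force
      then have "A \<subseteq> fst ` set T" using xs(2) by auto
      moreover have "set T \<subseteq> ?t ` {..k + 2}" using sub unfolding \<sigma>(2) by auto
      ultimately have "known G (told (set T)) d True (?n - 1)"
        using A(3) S(3) by blast
      then show "T \<in> vertices G ?n k d q"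
        using \<sigma> xs(1) sub valid comp by (auto simp: vertices_def \<Sigma>_def)
    qed
    moreover have "card K = (k + 3) ^ q"
    proof -
      have "inj_on (\<lambda>\<sigma>. map ?t (xs @ \<sigma>)) \<Sigma>" by (rule inj_onI) (metis fst_t same_append_eq)
      then show ?thesis unfolding K_def using card_image card\<Sigma> by metis
    qed
    moreover have "adjacent q T T'" if "T \<in> K" "T' \<in> K" "T \<noteq> T'" for T T'
    proof -
      obtain \<sigma> \<sigma>' where \<sigma>: "T = map ?t (xs @ \<sigma>)" "T' = map ?t (xs @ \<sigma>')" using \<open>T \<in> K\<close> \<open>T' \<in> K\<close> unfolding K_def by blast
      then have "map fst T \<noteq> map fst T'" using \<open>T \<noteq> T'\<close> fst_t by metis
      moreover have "take q T = take q T'" using \<sigma> xs(1) by simp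
      moreover have "\<forall>t\<in>set T. \<forall>t'\<in>set T'. compatible t t'" using \<sigma> comp by auto
      ultimately show ?thesis unfolding adjacent_def by metis
    qed
    ultimately show "\<exists>K \<subseteq> vertices G ?n k d q. card K = (k + 3) ^ q \<and> (\<forall>T\<in>K. \<forall>T'\<in>K. T \<noteq> T' \<longrightarrow> adjacent q T T')"
      by blast
  qed
qed

section \<open>Cliques and destructive control by adding voters\<close>

definition deg :: "vote multiset \<Rightarrow> nat \<Rightarrow> nat" where
  "deg V c = size {#v \<in># V. c \<in> v#}"

lemma deg_union [simp]: "deg (V + V') c = deg V c + deg V' c"
  by (simp add: deg_def)

lemma deg_mset_set: "finite F \<Longrightarrow> deg (mset_set F) c = card {e \<in> F. c \<in> e}"
  by (simp add: deg_def filter_mset_mset_set)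

lemma AV_score_eq_sum_deg: "finite w \<Longrightarrow> AV_score V w = (\<Sum>c\<in>w. deg V c)"
proof (induction V)
  case (add v V)
  have "(\<Sum>c\<in>w. deg (add_mset v V) c) = (\<Sum>c\<in>w. (if c \<in> v then 1 else 0) + deg V c)"
    by (intro sum.cong) (auto simp: deg_def)
  also have "\<dots> = card (v \<inter> w) + (\<Sum>c\<in>w. deg V c)"
    using add.prems by (simp add: sum.distrib sum.If_cases Int_commute)
  finally show ?case using add by (simp add: AV_score_def)
qed (simp add: AV_score_def deg_def)

text \<open>An exchange argument: replacing \<open>y\<close> by \<open>x\<close> changes the score
  by the difference of their degrees. If fewer than \<open>k\<close> candidates beat
  \<open>c\<close>, a winning committee without \<open>c\<close> has a member that does not beat
  \<open>c\<close>, and exchanging it for \<open>c\<close> keeps the committee winning. If at least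
  \<open>k\<close> beat \<open>c\<close>, a committee containing \<open>c\<close> misses one of
  them, and taking that one instead of \<open>c\<close> increases the score.\<close>

lemma AV_avoids_iff:
  assumes C: "finite C" "c \<in> C" and k: "0 < k" "k \<le> card C"
  shows "(\<forall>w\<in>AV C V k. c \<notin> w) \<longleftrightarrow> k \<le> card {c' \<in> C. deg V c < deg V c'}"
proof
  let ?B = "{c' \<in> C. deg V c < deg V c'}"
  have swap: "insert x (w - {y}) \<in> committees C k \<and>
      AV_score V (insert x (w - {y})) + deg V y = AV_score V w + deg V x"
    if "w \<in> committees C k" "x \<in> C" "x \<notin> w" "y \<in> w" for w x y
  proof -
    have w: "w \<subseteq> C" "card w = k" "finite w"
      using that C(1) finite_subset by (auto simp: committees_def)
    have "card (insert x (w - {y})) = k" using that w k(1) by simp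
    moreover have "(\<Sum>c\<in>w. deg V c) = deg V y + (\<Sum>c\<in>w - {y}. deg V c)"
      using w that by (simp add: sum.remove)
    ultimately show ?thesis using that w by (auto simp: AV_score_eq_sum_deg committees_def)
  qed
  {
    assume all: "\<forall>w\<in>AV C V k. c \<notin> w"
    show "k \<le> card ?B"
    proof (rule ccontr)
      assume less: "\<not> k \<le> card ?B"
      obtain w0 where "w0 \<in> committees C k"
        using obtain_subset_with_card_n[OF k(2)] by (auto simp: committees_def)
      moreover have "finite (committees C k)"
        by (rule finite_subset[of _ "Pow C"]) (use C in \<open>auto simp: committees_def\<close>)
      ultimately have "Max (AV_score V ` committees C k) \<in> AV_score V ` committees C k"
        and max: "\<And>w'. w' \<in> committees C k \<Longrightarrow> AV_score V w' \<le> Max (AV_score V ` committees C k)"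
        by (auto intro: Max_in Max_ge)
      then obtain w where w: "w \<in> committees C k"
          "\<And>w'. w' \<in> committees C k \<Longrightarrow> AV_score V w' \<le> AV_score V w"
        by auto
      then have AV: "w \<in> AV C V k" by (simp add: AV_def)
      then have cw: "c \<notin> w" using all by blast
      have "\<not> w \<subseteq> ?B"
        using less w(1) card_mono[of ?B w] C(1) by (auto simp: committees_def)
      then obtain y where y: "y \<in> w" "deg V y \<le> deg V c"
        using w(1) unfolding committees_def by (auto simp: subset_iff not_less)
      have "insert c (w - {y}) \<in> AV C V k"
        using swap[OF w(1) C(2) cw y(1)] y(2) w(2) unfolding AV_def by fastforce
      then show False using all by blast
    qed
  }
  {
    assume le: "k \<le> card ?B"
    show "\<forall>w\<in>AV C V k. c \<notin> w"
    proof (intro ballI notI)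
      fix w assume w: "w \<in> AV C V k" "c \<in> w"
      then have wc: "w \<in> committees C k" by (simp add: AV_def)
      then have fw: "finite w" "card w = k" using C(1) finite_subset by (auto simp: committees_def)
      have "\<not> ?B \<subseteq> w - {c}"
      proof
        assume "?B \<subseteq> w - {c}"
        then have "card ?B \<le> card (w - {c})" using fw by (intro card_mono) auto
        then show False using le fw w(2) k(1) by simp
      qed
      then obtain x where x: "x \<in> C" "deg V c < deg V x" "x \<notin> w" by auto
      from swap[OF wc x(1,3) w(2)] have "AV_score V w < AV_score V (insert x (w - {c}))"
        "insert x (w - {c}) \<in> committees C k" using x(2) by auto
      then show False using w(1) by (auto simp: AV_def not_less[symmetric])
    qed
  }
qed

text \<open>
  Candidate 0 has \<open>\<kappa> - 2\<close> approvals, each shared with a dummy candidate. With \<open>\<kappa> choose 2\<close> further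
  edges, \<open>\<kappa>\<close> candidates can be lifted above it only if these edges form a complete graph.
\<close>

definition clique_instance :: "nat \<Rightarrow> nat \<Rightarrow> nat set set \<Rightarrow> dcav_instance" where
  "clique_instance N \<kappa> E =
    \<lparr> candidates = {..N + (\<kappa> - 2)},
      registered = image_mset (\<lambda>j. {0, N + j}) (mset_set {1..\<kappa> - 2}),
      unregistered = mset_set E,
      committee_size = \<kappa>,
      distinguished = {0},
      budget = \<kappa> choose 2 \<rparr>"

lemma deg_registered:
  shows "deg (registered (clique_instance N \<kappa> E)) 0 = \<kappa> - 2"
    and "0 < c \<Longrightarrow> c \<le> N \<Longrightarrow> deg (registered (clique_instance N \<kappa> E)) c = 0"
    and "N < c \<Longrightarrow> deg (registered (clique_instance N \<kappa> E)) c \<le> 1"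
proof -
  have d: "deg (registered (clique_instance N \<kappa> E)) c = card {j \<in> {1..\<kappa> - 2}. c \<in> {0, N + j}}" for c
    by (simp add: deg_def clique_instance_def filter_mset_image_mset filter_mset_mset_set)
  have "{j \<in> {1..\<kappa> - 2}. 0 \<in> {0, N + j}} = {1..\<kappa> - 2}" by auto
  then show "deg (registered (clique_instance N \<kappa> E)) 0 = \<kappa> - 2" unfolding d by simp
  show "deg (registered (clique_instance N \<kappa> E)) c = 0" if "0 < c" "c \<le> N"
    unfolding d using that by simp
  show "deg (registered (clique_instance N \<kappa> E)) c \<le> 1" if "N < c"
  proof -
    have "{j \<in> {1..\<kappa> - 2}. c \<in> {0, N + j}} \<subseteq> {c - N}" using that by auto
    then show ?thesis unfolding d using card_mono[of "{c - N}"] by simp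
  qed
qed

lemma subset_mset_setE:
  assumes "finite E" "U \<subseteq># mset_set E"
  obtains F where "F \<subseteq> E" "U = mset_set F"
proof
  show "set_mset U \<subseteq> E" using assms set_mset_mono by fastforce
  have "count U x \<le> 1" for x
    using mset_subset_eq_count[OF assms(2), of x] by (simp add: count_mset_set' split: if_splits)
  then show "U = mset_set (set_mset U)"
    by (intro multiset_eqI) (metis One_nat_def count_greater_zero_iff count_mset_set(1,3) finite_set_mset
        le_antisym not_gr_zero Suc_leI)
qed

lemma two_choose_two: "2 * (n choose 2) = n * (n - 1)"
  unfolding choose_two by (cases n) auto

text \<open>Double counting of incidences between the added edges and \<kappa> candidates above the
  distinguished one. Validity is part of the equivalence because the budget may exceed the number of
  edges; in that case there is no clique either.\<close>

lemma clique_instance_correct: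
  fixes A :: "nat \<Rightarrow> nat \<Rightarrow> bool"
  assumes AV: "AV_uniform \<phi>" and \<kappa>: "3 \<le> \<kappa>" and sym: "\<And>a b. A a b \<Longrightarrow> A b a"
    and E: "E = {{a, b} | a b. a \<in> {1..N} \<and> b \<in> {1..N} \<and> a \<noteq> b \<and> A a b}"
  shows "valid_instance (clique_instance N \<kappa> E) \<and> controllable \<phi> (clique_instance N \<kappa> E) \<longleftrightarrow>
    (\<exists>K\<subseteq>{1..N}. card K = \<kappa> \<and> (\<forall>a\<in>K. \<forall>b\<in>K. a \<noteq> b \<longrightarrow> A a b))"
proof -
  let ?I = "clique_instance N \<kappa> E"
  let ?C = "{..N + (\<kappa> - 2)}"
  define R where "R = registered ?I"
  have E2: "e \<subseteq> {1..N} \<and> card e = 2" if "e \<in> E" for e using that unfolding E by auto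
  have finE: "finite E" by (rule finite_subset[of _ "Pow {1..N}"]) (use E2 in auto)
  have R2: "v \<subseteq> ?C \<and> card v = 2" if "v \<in># R" for v
    using that by (auto simp: R_def clique_instance_def card_insert_if)
  have election: "election ?C (R + mset_set F)" if "F \<subseteq> E" for F
    using R2 E2 that finite_subset[OF that finE] unfolding election_def by fastforce
  have avoids: "(\<forall>w\<in>\<phi> ?C (R + mset_set F) \<kappa>. {0} \<inter> w = {}) \<longleftrightarrow>
      \<kappa> \<le> card {c \<in> ?C. deg (R + mset_set F) 0 < deg (R + mset_set F) c}"
    if F: "F \<subseteq> E" and le: "\<kappa> \<le> card ?C" for F
  proof -
    have "\<forall>v\<in>#R + mset_set F. card v = 2"
      using R2 E2 F finite_subset[OF F finE] by auto
    then have "\<phi> ?C (R + mset_set F) \<kappa> = AV ?C (R + mset_set F) \<kappa>"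
      using AV election[OF F] le unfolding AV_uniform_def by blast
    then show ?thesis using AV_avoids_iff[of ?C 0 \<kappa> "R + mset_set F"] le \<kappa> by simp
  qed
  have deg0: "deg (R + mset_set F) 0 = \<kappa> - 2" if "F \<subseteq> E" for F
  proof -
    have "{e \<in> F. 0 \<in> e} = {}" using E2 that by fastforce
    then show ?thesis using deg_registered(1) finite_subset[OF that finE] by (simp add: R_def deg_mset_set)
  qed
  have degv: "deg (R + mset_set F) v = card {e \<in> F. v \<in> e}" if "F \<subseteq> E" "v \<in> {1..N}" for F v
    using deg_registered(2)[of v N] that finite_subset[OF that(1) finE] by (simp add: R_def deg_mset_set)
  show ?thesis
  proof
    assume "valid_instance ?I \<and> controllable \<phi> ?I"
    then obtain U where U: "\<kappa> \<le> card ?C" "U \<subseteq># mset_set E" "size U \<le> \<kappa> choose 2"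
        "\<forall>w\<in>\<phi> ?C (R + U) \<kappa>. {0} \<inter> w = {}"
      unfolding valid_instance_def controllable_def R_def by (auto simp: clique_instance_def)
    obtain F where F: "F \<subseteq> E" "U = mset_set F" using subset_mset_setE[OF finE U(2)] .
    have finF: "finite F" using F finE finite_subset by blast
    define B where "B = {c \<in> ?C. deg (R + mset_set F) 0 < deg (R + mset_set F) c}"
    have "B \<subseteq> {1..N}"
    proof
      fix c assume c: "c \<in> B"
      have "c \<noteq> 0" using c unfolding B_def by (metis (no_types, lifting) less_irrefl mem_Collect_eq)
      moreover have "c \<le> N"
      proof (rule ccontr)
        assume "\<not> c \<le> N"
        \<comment> \<open>A dummy is on no edge and has at most one approval, hence at most
          \<open>\<kappa> - 2\<close> of them; this uses \<open>3 \<le> \<kappa>\<close>.\<close>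
        have "deg R c \<le> 1" unfolding R_def using \<open>\<not> c \<le> N\<close> by (intro deg_registered(3)) simp
        moreover have "{e \<in> F. c \<in> e} = {}" using E2 F \<open>\<not> c \<le> N\<close> by fastforce
        then have "deg (mset_set F) c = 0" unfolding deg_mset_set[OF finF] by (simp only: card.empty)
        ultimately have "deg (R + mset_set F) c \<le> 1" by simp
        then show False using c deg0[OF F(1)] \<kappa> by (auto simp: B_def)
      qed
      ultimately show "c \<in> {1..N}" by simp
    qed
    moreover have "\<kappa> \<le> card B" using avoids[OF F(1) U(1)] U(4) unfolding B_def F(2) by blast
    ultimately obtain K where K: "K \<subseteq> B" "K \<subseteq> {1..N}" "card K = \<kappa>" "finite K"
      using obtain_subset_with_card_n by (metis subset_trans)
    have ge: "\<kappa> - 1 \<le> card {e \<in> F. v \<in> e}" if "v \<in> K" for v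
    proof -
      have "v \<in> B" "v \<in> {1..N}" using that K by auto
      then show ?thesis using degv[OF F(1), of v] deg0[OF F(1)] \<kappa> by (auto simp: B_def)
    qed
    \<comment> \<open>Beating \<open>\<kappa> - 2\<close> approvals takes
      \<open>\<kappa> - 1\<close> edges at each of the \<kappa> candidates. The edges of
      \<open>F\<close> supply at most twice the budget, which is the same number, so every edge lies
      within \<open>K\<close> and \<open>F\<close> has full size.\<close>
    have "\<kappa> * (\<kappa> - 1) \<le> (\<Sum>v\<in>K. card {e \<in> F. v \<in> e})"
      using sum_bounded_below[of K "\<kappa> - 1" "\<lambda>v. card {e \<in> F. v \<in> e}"] ge K(3) by simp
    also have "\<dots> = (\<Sum>e\<in>F. card (e \<inter> K))"
      using sum.swap_restrict[OF K(4) finF, of "\<lambda>_ _. 1::nat" "\<lambda>v e. v \<in> e"]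
      by (simp add: Int_def conj_commute)
    finally have count: "\<kappa> * (\<kappa> - 1) \<le> (\<Sum>e\<in>F. card (e \<inter> K))" .
    have cF: "card F \<le> \<kappa> choose 2" using U(3) F(2) by simp
    have cI: "card (e \<inter> K) \<le> 2" if "e \<in> F" for e
      using E2[of e] that F(1) card_mono[of e "e \<inter> K"] by (metis Int_lower1 card.infinite subsetD zero_neq_numeral)
    have sub: "e \<subseteq> K" if e: "e \<in> F" for e
    proof (rule ccontr)
      assume "\<not> e \<subseteq> K"
      then have "e \<inter> K \<subset> e" by blast
      then have "card (e \<inter> K) < 2"
        using psubset_card_mono[of e] E2[of e] e F(1) by (metis card.infinite subsetD zero_neq_numeral)
      then have "(\<Sum>e\<in>F. card (e \<inter> K)) < (\<Sum>e\<in>F. 2)"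
        using cI e finF by (intro sum_strict_mono_ex1) auto
      then show False using count cF two_choose_two[of \<kappa>] by simp
    qed
    have "\<kappa> choose 2 \<le> card F"
    proof -
      have "(\<Sum>e\<in>F. card (e \<inter> K)) \<le> 2 * card F" using sum_bounded_above[of F "\<lambda>e. card (e \<inter> K)" 2] cI by (simp add: mult.commute)
      then show ?thesis using count two_choose_two[of \<kappa>] by simp
    qed
    then have "F = {e. e \<subseteq> K \<and> card e = 2}"
      using sub E2 F(1) K n_subsets[OF K(4), of 2] cF by (intro card_subset_eq) auto
    then have "A a b" if "a \<in> K" "b \<in> K" "a \<noteq> b" for a b
    proof -
      have "{a, b} \<in> F" using that \<open>F = _\<close> by simp
      then have "{a, b} \<in> E" using F(1) by blast
      then obtain c d where "{a, b} = {c, d}" "A c d" unfolding E by blast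
      then show ?thesis using sym by (auto simp: doubleton_eq_iff)
    qed
    then show "\<exists>K\<subseteq>{1..N}. card K = \<kappa> \<and> (\<forall>a\<in>K. \<forall>b\<in>K. a \<noteq> b \<longrightarrow> A a b)" using K by blast
  next
    assume "\<exists>K\<subseteq>{1..N}. card K = \<kappa> \<and> (\<forall>a\<in>K. \<forall>b\<in>K. a \<noteq> b \<longrightarrow> A a b)"
    then obtain K where K: "K \<subseteq> {1..N}" "card K = \<kappa>" and cl: "\<And>a b. a \<in> K \<Longrightarrow> b \<in> K \<Longrightarrow> a \<noteq> b \<Longrightarrow> A a b"
      by blast
    have finK: "finite K" using K(1) finite_subset by blast
    define F where "F = {e. e \<subseteq> K \<and> card e = 2}"
    have F: "F \<subseteq> E"
    proof
      fix e assume "e \<in> F"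
      then obtain a b where "e = {a, b}" "a \<noteq> b" "a \<in> K" "b \<in> K" unfolding F_def by (auto simp: card_2_iff)
      then show "e \<in> E" using K(1) cl unfolding E by blast
    qed
    have cF: "card F = \<kappa> choose 2" unfolding F_def using n_subsets[OF finK] K(2) by simp
    \<comment> \<open>There are \<open>N + (\<kappa> - 2) + 1\<close> candidates, so one vertex
      suffices to make room for \<kappa> committee members.\<close>
    have "1 \<le> N" using K \<kappa> by (cases "N = 0") auto
    then have le: "\<kappa> \<le> card ?C" using \<kappa> by simp
    have "\<kappa> choose 2 \<le> card E" using card_mono[OF finE F] cF by simp
    then have valid: "valid_instance ?I"
      using election[of E] le unfolding valid_instance_def R_def by (simp add: clique_instance_def)
    have "K \<subseteq> {c \<in> ?C. deg (R + mset_set F) 0 < deg (R + mset_set F) c}"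
    proof
      fix v assume v: "v \<in> K"
      have "(\<lambda>b. {v, b}) ` (K - {v}) \<subseteq> {e \<in> F. v \<in> e}" using v by (auto simp: F_def)
      moreover have "inj_on (\<lambda>b. {v, b}) (K - {v})" by (auto simp: inj_on_def doubleton_eq_iff)
      moreover have "finite {e \<in> F. v \<in> e}" using finite_subset[OF F finE] by simp
      ultimately have "card (K - {v}) \<le> card {e \<in> F. v \<in> e}" by (intro card_inj_on_le)
      then have "deg (R + mset_set F) 0 < deg (R + mset_set F) v"
        using degv[OF F, of v] deg0[OF F] v K \<kappa> by (auto simp: subset_iff)
      then show "v \<in> {c \<in> ?C. deg (R + mset_set F) 0 < deg (R + mset_set F) c}" using v K(1) by auto
    qed
    from card_mono[OF _ this] have "\<kappa> \<le> card {c \<in> ?C. deg (R + mset_set F) 0 < deg (R + mset_set F) c}"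
      using K(2) by simp
    then have "\<forall>w\<in>\<phi> ?C (R + mset_set F) \<kappa>. {0} \<inter> w = {}" using avoids[OF F le] by blast
    then have "controllable \<phi> ?I"
      unfolding controllable_def R_def using F cF finE finite_subset[OF F finE]
      by (intro exI[of _ "mset_set F"]) (auto simp: clique_instance_def msubset_mset_set_iff)
    then show "valid_instance ?I \<and> controllable \<phi> ?I" using valid by blast
  qed
qed

section \<open>The reduction\<close>

definition nthT :: "tree \<Rightarrow> nat \<Rightarrow> tree" where
  "nthT x i = left ((right ^^ i) x)"

text \<open>Positions out of range yield \<open>Input\<close>. Therefore the circuit lemmas use a
  function \<open>G\<close> that has to agree with the circuit only at positions in range.\<close>

definition gateT :: "tree \<Rightarrow> nat \<Rightarrow> gate" where
  "gateT x i = gate_of (nthT x i)"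

definition predT :: "tree \<Rightarrow> tree list" where
  "predT g = (if g = Leaf then [] else if left g = Leaf then [right g] else list_of (right g))"

definition tokT :: "tree \<Rightarrow> token" where
  "tokT t = (nat_of (left t), nat_of (left (right t)), nat_of (right (right t)))"

definition toldT :: "tree \<Rightarrow> nat \<Rightarrow> bool \<Rightarrow> bool" where
  "toldT w = told (tokT ` set (list_of w))"

definition rangeT :: "tree \<Rightarrow> tree list" where
  "rangeT t = Leaf # suffs t"

text \<open>All words of length \<open>q\<close> over \<open>L\<close>. Their number is a power of
  the length of \<open>L\<close> with exponent \<open>q\<close>, which is polynomial because
  \<open>q\<close> is fixed by the depth.\<close>

fun listsT :: "nat \<Rightarrow> tree list \<Rightarrow> tree list" where
  "listsT 0 L = [Leaf]"
| "listsT (Suc q) L = concat (map (\<lambda>t. map (Node t) (listsT q L)) L)"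

text \<open>A suffix \<open>s\<close> stands for the position \<open>nat_of (right s)\<close>, so
  the positions start at 0. The test \<open>left ... = Leaf\<close> singles out inputs and
  negations, whose arity is not restricted.\<close>

definition circuit_ok :: "tree \<Rightarrow> bool" where
  "circuit_ok x \<longleftrightarrow> x \<noteq> Leaf \<and> (\<forall>s\<in>set (suffs x).
    (left (nthT x (nat_of (right s))) = Leaf \<or> 2 \<le> length (predT (nthT x (nat_of (right s))))) \<and>
    (\<forall>j\<in>set (predT (nthT x (nat_of (right s)))). nat_of j < nat_of (right s)))"

definition tokensT :: "tree \<Rightarrow> tree \<Rightarrow> tree list" where
  "tokensT x k = filter (\<lambda>t. valid_token (gateT x) (nat_of x) (nat_of k) (tokT t))
    (concat (map (\<lambda>i. concat (map (\<lambda>a. map (\<lambda>b. Node i (Node a b)) (rangeT x)) (rangeT x)))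
      (rangeT (Node Leaf (Node Leaf k)))))"

definition verticesT :: "nat \<Rightarrow> tree \<Rightarrow> tree \<Rightarrow> tree list" where
  "verticesT d x k = filter (\<lambda>w. (\<forall>t\<in>set (list_of w). \<forall>t'\<in>set (list_of w). compatible (tokT t) (tokT t')) \<and>
      known (gateT x) (toldT w) d True (nat_of (right x)))
    (listsT (2 * 2 ^ d) (tokensT x k))"

definition adjacentT :: "nat \<Rightarrow> tree \<Rightarrow> tree \<Rightarrow> bool" where
  "adjacentT q w w' \<longleftrightarrow>
    (\<forall>r<q. nat_of (left (nthT w r)) = nat_of (left (nthT w' r))) \<and>
    \<not> (\<forall>r<2 * q. nat_of (left (nthT w r)) = nat_of (left (nthT w' r))) \<and>
    (\<forall>t\<in>set (list_of w). \<forall>t'\<in>set (list_of w'). compatible (tokT t) (tokT t'))"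

text \<open>
  A list serves as a name for its own length, so the nonempty suffixes of a list of vertices are
  distinct candidates, and the head of each is the vertex that it names.
\<close>

definition pairsT :: "(tree \<Rightarrow> tree \<Rightarrow> bool) \<Rightarrow> tree \<Rightarrow> tree list" where
  "pairsT A v = concat (map (\<lambda>s. map (\<lambda>t. tol [s, t]) (filter (\<lambda>t. A (left s) (left t)) (suffs (right s)))) (suffs v))"

text \<open>Only the length of this list matters: it is the clique size
  \<open>(k + 3) ^ 2 ^ d\<close> in unary.\<close>

definition slotsT :: "nat \<Rightarrow> tree \<Rightarrow> tree" where
  "slotsT d k = tol (listsT (2 ^ d) (rangeT (Node Leaf (Node Leaf k))))"

text \<open>Numbers arise as lengths of lists: \<open>m\<close> has length \<kappa>,
  \<open>r\<close> has length \<open>\<kappa> - 2\<close>, and the pairs from \<open>m\<close>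
  number \<kappa> choose 2. \<open>Leaf\<close> names candidate 0, the suffixes of \<open>v\<close>
  name the vertices, and a suffix of \<open>r\<close> put in front of \<open>v\<close> names a
  dummy.\<close>

definition reduction_instance :: "nat \<Rightarrow> tree \<Rightarrow> tree \<Rightarrow> tree" where
  "reduction_instance d x k =
    (let v = tol (verticesT d x k); m = slotsT d k; r = right (right m) in
      Node (tol (rangeT (tol (list_of r @ list_of v))))
        (Node (tol (map (\<lambda>s. tol [Leaf, tol (list_of s @ list_of v)]) (suffs r)))
          (Node (tol (pairsT (adjacentT (2 ^ d)) v))
            (Node m (Node (tol [Leaf]) (tol (pairsT (\<lambda>_ _. True) m)))))))"

text \<open>Unlike the numbers inside the instance, the parameter must be literally a
  \<open>tree_of_nat\<close>, so all entries are replaced by \<open>Leaf\<close>.\<close>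

definition reduction_parameter :: "nat \<Rightarrow> tree \<Rightarrow> tree" where
  "reduction_parameter d k =
    (let m = slotsT d k in
      tol (map (\<lambda>_. Leaf) (list_of m @ pairsT (\<lambda>_ _. True) m @ list_of (right (right m)))))"

text \<open>Ill-formed circuits, and those violating the weft or depth bound, go to the tree
  \<open>Leaf\<close> with parameter 0. This is a no-instance, since it has no distinguished
  candidate.\<close>

definition reduction :: "nat \<Rightarrow> tree \<Rightarrow> tree" where
  "reduction d e =
    (if circuit_ok (left e) \<and> weft1_le (gateT (left e)) d (nat_of (right (left e)))
     then Node (reduction_instance d (left e) (right e)) (reduction_parameter d (right e))
     else Node Leaf Leaf)"

subsection \<open>Running time\<close>

lemma fpl_comp: "fpl L \<Longrightarrow> fp f \<Longrightarrow> fpl (\<lambda>x. L (f x))"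
  unfolding fpl_def by (rule fp_comp)

lemma fpb_disj: "fpb p \<Longrightarrow> fpb q \<Longrightarrow> fpb (\<lambda>e. p e \<or> q e)"
  using fpb_imp[OF fpb_not, of p q] by (simp add: disj_imp)

lemma fpb_eq_const: "fpb p \<Longrightarrow> fpb (\<lambda>e. p e \<longleftrightarrow> b)"
  by (cases b) (simp_all add: fpb_not)

lemma fp_nthT:
  assumes "fp X" "fpn i"
  shows "fp (\<lambda>e. nthT (X e) (i e))"
proof -
  obtain f where f: "fp f" "\<And>e. nat_of (f e) = i e" using assms(2) unfolding fpn_def by blast
  have "fp (\<lambda>e. left ((right ^^ length (list_of (f e))) (X e)))"
    by (intro fp_left fp_funpow_right fpl_list_of assms f)
  then show ?thesis using f(2) by (simp add: nthT_def nat_of_def)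
qed

lemmas fp_intros = fp_id fp_left fp_right fp_Node fp_const fp_if fp_nthT fp_tol
  fpl_list_of fpl_Nil fpl_Cons fpl_append fpl_map fpl_concat_map fpl_filter fpl_suffs fpl_if
  fpb_const fpb_if fpb_not fpb_conj fpb_imp fpb_disj fpb_eq_const fpb_ball fpb_bex fpb_eq_Leaf fpb_le fpb_less
  fpb_nat_eq fpb_all_less fpn_nat_of fpn_length fpn_const fpn_Suc

lemma fpl_predT: "fp g \<Longrightarrow> fpl (\<lambda>e. predT (g e))"
  unfolding predT_def by (intro fp_intros)

lemma fpl_rangeT: "fp f \<Longrightarrow> fpl (\<lambda>e. rangeT (f e))"
  unfolding rangeT_def by (intro fp_intros)

lemma fpl_listsT: "fpl L \<Longrightarrow> fpl (\<lambda>e. listsT q (L e))"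
proof (induction q arbitrary: L)
  case (Suc q)
  show ?case unfolding listsT.simps by (intro fp_intros Suc fpl_comp[OF Suc(2)])
qed (auto intro: fp_intros)

lemma fpb_circuit_ok: assumes "fp x" shows "fpb (\<lambda>e. circuit_ok (x e))"
  unfolding circuit_ok_def by (intro fp_intros fpl_predT fp_comp[OF assms])

lemma preds_gate_of: "preds (gate_of g) = map nat_of (predT g)"
  by (cases g rule: gate_of.cases) (auto simp: predT_def nat_list_of_def)

lemma preds_gateT: "preds (gateT x i) = map nat_of (predT (nthT x i))"
  by (simp add: gateT_def preds_gate_of)

text \<open>For fixed \<open>d\<close> the recursion unrolls into nested loops over predecessors.
  The arguments are arbitrary programs of the input because each loop extends the
  environment.\<close>

lemma fpb_small_le: "fp x \<Longrightarrow> fp i \<Longrightarrow> fpb (\<lambda>e. small_le (gateT (x e)) d (nat_of (i e)))"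
proof (induction d arbitrary: x i)
  case 0
  have "fpb (\<lambda>e. tol (predT (nthT (x e) (nat_of (i e)))) = Leaf)"
    by (intro fp_intros fpl_predT 0)
  then show ?case by (simp add: preds_gateT)
next
  case (Suc d)
  have "fpb (\<lambda>e. length (predT (nthT (x e) (nat_of (i e)))) \<le> 2 \<and>
      (\<forall>j\<in>set (predT (nthT (x e) (nat_of (i e)))). small_le (gateT (x e)) d (nat_of j)))"
    by (intro fp_intros fpl_predT Suc fp_comp[OF Suc(2)])
  then show ?case by (simp add: preds_gateT)
qed

lemma fpb_weft1_le: "fp x \<Longrightarrow> fp i \<Longrightarrow> fpb (\<lambda>e. weft1_le (gateT (x e)) d (nat_of (i e)))"
proof (induction d arbitrary: x i)
  case 0
  have "fpb (\<lambda>e. tol (predT (nthT (x e) (nat_of (i e)))) = Leaf)"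
    by (intro fp_intros fpl_predT 0)
  then show ?case by (simp add: preds_gateT)
next
  case (Suc d)
  have "fpb (\<lambda>e. if 2 < length (predT (nthT (x e) (nat_of (i e)))) then
      (\<forall>j\<in>set (predT (nthT (x e) (nat_of (i e)))). small_le (gateT (x e)) d (nat_of j))
      else (\<forall>j\<in>set (predT (nthT (x e) (nat_of (i e)))). weft1_le (gateT (x e)) d (nat_of j)))"
    by (intro fp_intros fpl_predT Suc fpb_small_le fp_comp[OF Suc(2)])
  then show ?case by (simp only: weft1_le.simps preds_gateT length_map list.set_map ball_simps)
qed

lemma fpb_toldT: "fp w \<Longrightarrow> fpn i \<Longrightarrow> fpb (\<lambda>e. toldT (w e) (i e) b)"
proof -
  assume w: "fp w" and "fpn i"
  then obtain f where f: "fp f" "\<And>e. nat_of (f e) = i e" unfolding fpn_def by blast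
  have "toldT (w e) (i e) b \<longleftrightarrow> (\<exists>t\<in>set (list_of (w e)). nat_of (left (right t)) \<le> nat_of (f e) \<and>
      nat_of (f e) < nat_of (right (right t)) \<and>
      ((0 < nat_of (left t) \<and> nat_of (left (right t)) = nat_of (f e)) \<longleftrightarrow> b))" for e
    by (simp add: toldT_def told_def tokT_def f(2))
  then show ?thesis by (simp only:) (intro fp_intros w fp_comp[OF f(1)])
qed

lemma fpb_known: "fp x \<Longrightarrow> fp w \<Longrightarrow> fp i \<Longrightarrow> fpb (\<lambda>e. known (gateT (x e)) (toldT (w e)) d b (nat_of (i e)))"
proof (induction d arbitrary: x w i b)
  case 0
  then show ?case by (simp only: known.simps) (intro fp_intros fpb_toldT)
next
  case (Suc d)
  define g where "g e = nthT (x e) (nat_of (i e))" for e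
  have g: "fp g" unfolding g_def by (intro fp_intros Suc)
  let ?k = "\<lambda>e. known (gateT (x e)) (toldT (w e)) d"
  have "known (gateT (x e)) (toldT (w e)) (Suc d) b (nat_of (i e)) \<longleftrightarrow>
    (if g e = Leaf then toldT (w e) (nat_of (i e)) b
     else if left (g e) = Leaf then ?k e (\<not> b) (nat_of (right (g e)))
     else if left (left (g e)) = Leaf then
       (if b then
          if 2 < length (list_of (right (g e))) then \<not> (\<exists>j\<in>set (list_of (right (g e))). ?k e False (nat_of j))
          else \<forall>j\<in>set (list_of (right (g e))). ?k e True (nat_of j)
        else \<exists>j\<in>set (list_of (right (g e))). ?k e False (nat_of j))
     else
       (if b then \<exists>j\<in>set (list_of (right (g e))). ?k e True (nat_of j)
        else if 2 < length (list_of (right (g e))) then \<not> (\<exists>j\<in>set (list_of (right (g e))). ?k e True (nat_of j))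
          else \<forall>j\<in>set (list_of (right (g e))). ?k e False (nat_of j)))" for e
    unfolding known.simps gateT_def[of "x e" "nat_of (i e)"] g_def[symmetric]
    by (cases "g e" rule: gate_of.cases) (simp_all add: nat_list_of_def)
  then show ?case
    by (simp only:) (intro fp_intros fpb_toldT Suc g fp_comp[OF Suc(2)] fp_comp[OF Suc(3)] fp_comp[OF Suc(4)])
qed

lemma gateT_eq_Input: "gateT x i = Input \<longleftrightarrow> nthT x i = Leaf"
  unfolding gateT_def by (cases "nthT x i" rule: gate_of.cases) auto

lemma fpb_valid_token:
  assumes "fp x" "fp k" "fp t"
  shows "fpb (\<lambda>e. valid_token (gateT (x e)) (nat_of (x e)) (nat_of (k e)) (tokT (t e)))"
proof -
  have *: "i \<le> m + 2 \<longleftrightarrow> i \<le> Suc (Suc m)" for i m :: nat by simp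
  show ?thesis unfolding valid_token_def tokT_def prod.case gateT_eq_Input *
    by (intro fp_intros assms)
qed

lemma fpb_compatible: "fp t \<Longrightarrow> fp u \<Longrightarrow> fpb (\<lambda>e. compatible (tokT (t e)) (tokT (u e)))"
  unfolding compatible_def tokT_def prod.case by (intro fp_intros)

lemma fpl_tokensT: assumes "fp x" "fp k" shows "fpl (\<lambda>e. tokensT (x e) (k e))"
  unfolding tokensT_def
  by (intro fp_intros fpb_valid_token fpl_rangeT fp_comp[OF assms(1)] fp_comp[OF assms(2)])

lemma fpl_verticesT: assumes "fp x" "fp k" shows "fpl (\<lambda>e. verticesT d (x e) (k e))"
  unfolding verticesT_def
  by (intro fp_intros fpb_compatible fpb_known fpl_listsT fpl_tokensT
      fp_comp[OF assms(1)] fp_comp[OF assms(2)])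

lemma fpb_adjacentT: assumes "fp w" "fp w'" shows "fpb (\<lambda>e. adjacentT q (w e) (w' e))"
  unfolding adjacentT_def by (intro fp_intros fpb_compatible fp_comp[OF assms(1)] fp_comp[OF assms(2)])

lemma fpl_pairsT:
  assumes "fp v" "\<And>x y. fp x \<Longrightarrow> fp y \<Longrightarrow> fpb (\<lambda>z. A (x z) (y z))"
  shows "fpl (\<lambda>e. pairsT A (v e))"
  unfolding pairsT_def by (intro fp_intros assms)

lemma fp_slotsT: "fp k \<Longrightarrow> fp (\<lambda>e. slotsT d (k e))"
  unfolding slotsT_def by (intro fp_intros fpl_listsT fpl_rangeT)

lemma fp_reduction: "fp (reduction d)"
proof -
  have "fp (\<lambda>e. if circuit_ok (left e) \<and> weft1_le (gateT (left e)) d (nat_of (right (left e)))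
     then Node (reduction_instance d (left e) (right e)) (reduction_parameter d (right e))
     else Node Leaf Leaf)"
    unfolding reduction_instance_def reduction_parameter_def Let_def
    by (intro fp_intros fpb_circuit_ok fpb_weft1_le fpl_rangeT fp_slotsT fpl_verticesT fpl_pairsT fpb_adjacentT)
  then show ?thesis unfolding reduction_def[abs_def] .
qed

subsection \<open>Correctness\<close>

lemma nat_of_right: "nat_of (right x) = nat_of x - 1"
  by (cases x) auto

lemma nat_of_tol [simp]: "nat_of (tol xs) = length xs"
  by (simp add: nat_of_def)

lemma length_list_of [simp]: "length (list_of x) = nat_of x"
  by (simp add: nat_of_def)

lemma length_suffs [simp]: "length (suffs x) = nat_of x"
  by (induction x) auto

lemma nthT_eq_nth: "i < nat_of x \<Longrightarrow> nthT x i = list_of x ! i"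
proof (induction x arbitrary: i)
  case (Node a b)
  then show ?case by (cases i) (auto simp: nthT_def funpow_swap1)
qed simp

lemma length_circuit_of [simp]: "length (circuit_of x) = nat_of x"
  by (simp add: circuit_of_def)

lemma gateT_eq_nth: "i < length (circuit_of x) \<Longrightarrow> gateT x i = circuit_of x ! i"
  by (simp add: gateT_def circuit_of_def nthT_eq_nth)

lemma nat_of_right_suffs: "(\<lambda>s. nat_of (right s)) ` set (suffs x) = {..<nat_of x}"
  by (induction x) (auto simp: lessThan_Suc)

lemma nat_of_rangeT: "nat_of ` set (rangeT x) = {..nat_of x}"
proof -
  have "nat_of ` set (suffs x) = {1..nat_of x}"
    by (induction x) (auto simp: atLeastAtMostSuc_conv)
  then show ?thesis by (auto simp: rangeT_def)
qed

lemma arity_ok_gate_of: "arity_ok (gate_of g) \<longleftrightarrow> left g = Leaf \<or> 2 \<le> length (predT g)"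
  by (cases g rule: gate_of.cases) (auto simp: predT_def nat_list_of_def)

lemma circuit_ok_iff: "circuit_ok x \<longleftrightarrow> wf_circuit (circuit_of x)"
proof -
  have "wf_circuit (circuit_of x) \<longleftrightarrow> circuit_of x \<noteq> [] \<and>
      (\<forall>i\<in>{..<nat_of x}. arity_ok (gateT x i) \<and> (\<forall>j\<in>set (preds (gateT x i)). j < i))"
    unfolding wf_circuit_def by (auto simp: gateT_eq_nth)
  also have "\<dots> \<longleftrightarrow> circuit_ok x"
    unfolding circuit_ok_def nat_of_right_suffs[symmetric] preds_gateT
    by (cases x) (simp_all add: gateT_def arity_ok_gate_of circuit_of_def)
  finally show ?thesis by blast
qed

lemma list_of_listsT: "list_of ` set (listsT q L) = {ts. length ts = q \<and> set ts \<subseteq> set L}"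
proof (induction q)
  case (Suc q)
  have "list_of ` set (listsT (Suc q) L) = {t # ts | t ts. t \<in> set L \<and> ts \<in> list_of ` set (listsT q L)}"
    by force
  also have "\<dots> = {ts. length ts = Suc q \<and> set ts \<subseteq> set L}"
    unfolding Suc by (auto simp: length_Suc_conv)
  finally show ?case .
qed auto

lemma length_listsT: "length (listsT q L) = length L ^ q"
  by (induction q) (simp_all add: length_concat comp_def sum_list_triv)

lemma tokT_tokensT: "tokT ` set (tokensT x k) = {t. valid_token (gateT x) (nat_of x) (nat_of k) t}"
proof -
  have "\<exists>t\<in>set (tokensT x k). tokT t = (i, a, b)"
    if v: "valid_token (gateT x) (nat_of x) (nat_of k) (i, a, b)" for i a b
  proof -
    have "i \<in> {..nat_of (Node Leaf (Node Leaf k))}" "a \<in> {..nat_of x}" "b \<in> {..nat_of x}"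
      using v by (auto simp: valid_token_def)
    then obtain ti ta tb where t: "ti \<in> set (rangeT (Node Leaf (Node Leaf k)))" "ta \<in> set (rangeT x)"
        "tb \<in> set (rangeT x)" "i = nat_of ti" "a = nat_of ta" "b = nat_of tb"
      unfolding nat_of_rangeT[symmetric] by blast
    then have "Node ti (Node ta tb) \<in> set (tokensT x k)"
      using v unfolding tokensT_def by (auto simp: tokT_def)
    then show ?thesis using t by (intro bexI[of _ "Node ti (Node ta tb)"]) (simp_all add: tokT_def)
  qed
  then show ?thesis by (force simp: tokensT_def)
qed

lemma verticesT_eq:
  "(\<lambda>w. map tokT (list_of w)) ` set (verticesT d x k) = vertices (gateT x) (nat_of x) (nat_of k) d (2 ^ d)"
  (is "?f ` _ = _")
proof -
  let ?L = "listsT (2 * 2 ^ d) (tokensT x k)"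
  have "?f ` set ?L = map tokT ` {ts. length ts = 2 * 2 ^ d \<and> set ts \<subseteq> set (tokensT x k)}"
    unfolding list_of_listsT[symmetric] by (simp add: image_image)
  also have "\<dots> = {T. length T = 2 * 2 ^ d \<and> T \<in> map tokT ` lists (set (tokensT x k))}"
    by (auto simp: lists_eq_set)
  also have "\<dots> = {T. length T = 2 * 2 ^ d \<and> (\<forall>t\<in>set T. valid_token (gateT x) (nat_of x) (nat_of k) t)}"
    unfolding lists_image[symmetric] tokT_tokensT by (auto simp: lists_eq_set)
  finally have L: "?f ` set ?L = \<dots>" .
  define good where "good T \<longleftrightarrow> (\<forall>t\<in>set T. \<forall>t'\<in>set T. compatible t t') \<and>
    known (gateT x) (told (set T)) d True (nat_of x - 1)" for T
  have "verticesT d x k = filter (\<lambda>w. good (?f w)) ?L"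
    unfolding verticesT_def good_def by (simp add: toldT_def nat_of_right)
  then have "?f ` set (verticesT d x k) = {T \<in> ?f ` set ?L. good T}" by auto
  then show ?thesis unfolding L vertices_def good_def by auto
qed

lemma length_verticesT: "w \<in> set (verticesT d x k) \<Longrightarrow> nat_of w = 2 * 2 ^ d"
proof -
  assume "w \<in> set (verticesT d x k)"
  then have "list_of w \<in> list_of ` set (listsT (2 * 2 ^ d) (tokensT x k))" unfolding verticesT_def by simp
  then show ?thesis unfolding list_of_listsT by simp
qed

lemma adjacentT_iff:
  assumes "nat_of w = 2 * q" "nat_of w' = 2 * q"
  shows "adjacentT q w w' \<longleftrightarrow> adjacent q (map tokT (list_of w)) (map tokT (list_of w'))"
proof -
  have fst_tokT: "fst (tokT t) = nat_of (left t)" for t by (simp add: tokT_def)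
  have nth: "nthT w r = list_of w ! r" "nthT w' r = list_of w' ! r" if "r < 2 * q" for r
    using that assms nthT_eq_nth by auto
  have "(\<forall>r<q. nat_of (left (nthT w r)) = nat_of (left (nthT w' r))) \<longleftrightarrow>
      map fst (take q (map tokT (list_of w))) = map fst (take q (map tokT (list_of w')))"
    using assms by (auto simp: list_eq_iff_nth_eq fst_tokT nth)
  moreover have "(\<forall>r<2 * q. nat_of (left (nthT w r)) = nat_of (left (nthT w' r))) \<longleftrightarrow>
      map fst (map tokT (list_of w)) = map fst (map tokT (list_of w'))"
    using assms by (auto simp: list_eq_iff_nth_eq fst_tokT nth)
  ultimately show ?thesis unfolding adjacentT_def adjacent_def by simp
qed

lemma adjacentT_sym: "adjacentT q w w' \<Longrightarrow> adjacentT q w' w"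
  unfolding adjacentT_def using compatible_sym by metis

text \<open>Counting from the end keeps names stable when the list grows at the front, as it does in
  inductions over \<open>v\<close>.\<close>

definition vertexT :: "tree \<Rightarrow> nat \<Rightarrow> tree" where
  "vertexT v a = list_of v ! (nat_of v - a)"

lemma vertexT_Node:
  "vertexT (Node u v) (Suc (nat_of v)) = u"
  "a \<le> nat_of v \<Longrightarrow> vertexT (Node u v) a = vertexT v a"
  by (simp_all add: vertexT_def Suc_diff_le)

lemma vertexT_image: "vertexT v ` {1..nat_of v} = set (list_of v)"
proof (induction v)
  case (Node u v)
  have "{1..nat_of (Node u v)} = insert (Suc (nat_of v)) {1..nat_of v}" by auto
  moreover have "vertexT (Node u v) ` {1..nat_of v} = vertexT v ` {1..nat_of v}"
    by (intro image_cong) (auto simp: vertexT_Node)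
  ultimately show ?case using Node by (simp add: vertexT_Node)
qed simp

lemma mset_suffs:
  "mset (map nat_of (filter (\<lambda>s. P (left s)) (suffs v))) = mset_set {a \<in> {1..nat_of v}. P (vertexT v a)}"
proof (induction v)
  case (Node u v)
  have "{a \<in> {1..nat_of (Node u v)}. P (vertexT (Node u v) a)} =
    (if P u then insert (Suc (nat_of v)) else id) {a \<in> {1..nat_of v}. P (vertexT v a)}"
    by (auto simp: vertexT_Node le_Suc_eq)
  then show ?case using Node by simp
qed simp

definition edgesT :: "(tree \<Rightarrow> tree \<Rightarrow> bool) \<Rightarrow> tree \<Rightarrow> nat set set" where
  "edgesT A v = {{a, b} | a b. a \<in> {1..nat_of v} \<and> b \<in> {1..nat_of v} \<and> a \<noteq> b \<and> A (vertexT v a) (vertexT v b)}"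

lemma finite_edgesT: "finite (edgesT A v)"
  by (rule finite_subset[of _ "Pow {1..nat_of v}"]) (auto simp: edgesT_def)

lemma card_edgesT: "e \<in> edgesT A v \<Longrightarrow> card e = 2"
  by (auto simp: edgesT_def)

lemma votes_of_tol: "votes_of (tol xs) = image_mset cand_set_of (mset xs)"
  by (simp add: votes_of_def)

lemma cand_set_of_tol: "cand_set_of (tol xs) = nat_of ` set xs"
  by (simp add: cand_set_of_def nat_list_of_def)

lemma pairsT_Node:
  "pairsT A (Node u v) = map (\<lambda>t. tol [Node u v, t]) (filter (\<lambda>t. A u (left t)) (suffs v)) @ pairsT A v"
  by (simp add: pairsT_def)

text \<open>Each unordered pair is tested once, with the longer suffix first, so no vote is repeated
  and symmetry makes the order of the test irrelevant. In the induction, the new head has a fresh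
  name and contributes exactly the edges at that name.\<close>

lemma votes_of_pairsT:
  assumes sym: "\<And>x y. A x y \<Longrightarrow> A y x"
  shows "votes_of (tol (pairsT A v)) = mset_set (edgesT A v)"
proof (induction v)
  case Leaf
  then show ?case by (simp add: pairsT_def votes_of_def edgesT_def)
next
  case (Node u v)
  let ?n = "Suc (nat_of v)"
  define B where "B = {b \<in> {1..nat_of v}. A u (vertexT v b)}"
  have "image_mset cand_set_of (mset (map (\<lambda>t. tol [Node u v, t]) (filter (\<lambda>t. A u (left t)) (suffs v))))
      = image_mset (\<lambda>b. {?n, b}) (mset (map nat_of (filter (\<lambda>t. A u (left t)) (suffs v))))"
    by (simp add: cand_set_of_tol image_mset.compositionality comp_def del: tol.simps)
  also have "\<dots> = image_mset (\<lambda>b. {?n, b}) (mset_set B)"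
    using mset_suffs[of "A u" v] by (simp add: B_def)
  also have "\<dots> = mset_set ((\<lambda>b. {?n, b}) ` B)"
    by (rule image_mset_mset_set) (auto simp: inj_on_def doubleton_eq_iff)
  finally have "votes_of (tol (pairsT A (Node u v))) = mset_set ((\<lambda>b. {?n, b}) ` B) + mset_set (edgesT A v)"
    using Node(2) unfolding pairsT_Node by (simp add: votes_of_tol)
  also have "\<dots> = mset_set ((\<lambda>b. {?n, b}) ` B \<union> edgesT A v)"
  proof (rule mset_set_Union[symmetric])
    show "(\<lambda>b. {?n, b}) ` B \<inter> edgesT A v = {}"
    proof -
      have "?n \<notin> e" if "e \<in> edgesT A v" for e using that by (auto simp: edgesT_def)
      then show ?thesis by blast
    qed
  qed (simp_all add: finite_edgesT B_def)
  also have "(\<lambda>b. {?n, b}) ` B \<union> edgesT A v = edgesT A (Node u v)"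
  proof (intro subset_antisym subsetI)
    fix e assume "e \<in> (\<lambda>b. {?n, b}) ` B \<union> edgesT A v"
    then show "e \<in> edgesT A (Node u v)"
    proof
      assume "e \<in> (\<lambda>b. {?n, b}) ` B"
      then obtain b where b: "b \<in> {1..nat_of v}" "A u (vertexT v b)" "e = {?n, b}" unfolding B_def by auto
      then show ?thesis unfolding edgesT_def
        by (intro CollectI exI[of _ ?n] exI[of _ b]) (auto simp: vertexT_Node)
    next
      assume "e \<in> edgesT A v"
      then obtain a b where "a \<in> {1..nat_of v}" "b \<in> {1..nat_of v}" "a \<noteq> b" "A (vertexT v a) (vertexT v b)"
          "e = {a, b}" unfolding edgesT_def by auto
      then show ?thesis unfolding edgesT_def
        by (intro CollectI exI[of _ a] exI[of _ b]) (auto simp: vertexT_Node)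
    qed
  next
    fix e assume "e \<in> edgesT A (Node u v)"
    then obtain a b where ab: "a \<in> {1..?n}" "b \<in> {1..?n}" "a \<noteq> b"
        "A (vertexT (Node u v) a) (vertexT (Node u v) b)" "e = {a, b}" unfolding edgesT_def by auto
    consider "a = ?n" "b \<le> nat_of v" | "b = ?n" "a \<le> nat_of v" | "a \<le> nat_of v" "b \<le> nat_of v"
      using ab by fastforce
    then show "e \<in> (\<lambda>b. {?n, b}) ` B \<union> edgesT A v"
    proof cases
      case 1
      then have "b \<in> B" using ab by (simp add: B_def vertexT_Node)
      then show ?thesis using 1 ab by blast
    next
      case 2
      then have "a \<in> B" using ab sym by (simp add: B_def vertexT_Node)
      then show ?thesis using 2 ab by (auto simp: insert_commute)
    next
      case 3
      then show ?thesis using ab unfolding edgesT_def by (auto simp: vertexT_Node)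
    qed
  qed
  finally show ?case .
qed

lemma length_pairsT: "length (pairsT (\<lambda>_ _. True) v) = nat_of v choose 2"
proof (induction v)
  case (Node u v)
  then show ?case by (simp add: pairsT_Node numeral_2_eq_2)
qed (simp add: pairsT_def)

lemma nat_of_slotsT: "nat_of (slotsT d k) = (nat_of k + 3) ^ 2 ^ d"
  by (simp add: slotsT_def length_listsT rangeT_def numeral_3_eq_3)

lemma dcav_of_reduction_instance:
  fixes v x k :: tree and d :: nat
  defines "v \<equiv> tol (verticesT d x k)"
  shows "dcav_of (reduction_instance d x k) =
    clique_instance (nat_of v) ((nat_of k + 3) ^ 2 ^ d) (edgesT (adjacentT (2 ^ d)) v)"
proof -
  define m where "m = slotsT d k"
  define r where "r = right (right m)"
  define \<kappa> where "\<kappa> = (nat_of k + 3) ^ 2 ^ d"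
  have m: "nat_of m = \<kappa>" by (simp add: m_def \<kappa>_def nat_of_slotsT)
  have r: "nat_of r = \<kappa> - 2" by (simp add: r_def nat_of_right m)
  have *: "votes_of (tol (map (\<lambda>s. tol [Leaf, tol (list_of s @ list_of v)]) (suffs r))) =
      image_mset (\<lambda>j. {0, nat_of v + j}) (mset (map nat_of (suffs r)))"
    by (simp add: votes_of_tol cand_set_of_tol image_mset.compositionality comp_def add.commute del: tol.simps)
  have reg: "votes_of (tol (map (\<lambda>s. tol [Leaf, tol (list_of s @ list_of v)]) (suffs r))) =
      image_mset (\<lambda>j. {0, nat_of v + j}) (mset_set {1..\<kappa> - 2})"
  proof -
    have "filter (\<lambda>_. True) (suffs r) = suffs r" "{a \<in> {1..\<kappa> - 2}. True} = {1..\<kappa> - 2}" by auto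
    then show ?thesis using mset_suffs[of "\<lambda>_. True" r] * unfolding r by (simp only:)
  qed
  show ?thesis
    unfolding dcav_of_def reduction_instance_def Let_def v_def[symmetric] m_def[symmetric] r_def[symmetric]
      clique_instance_def \<kappa>_def[symmetric]
    using reg m r
    by (simp add: cand_set_of_tol nat_of_rangeT votes_of_pairsT[OF adjacentT_sym] length_pairsT add.commute
        del: tol.simps)
qed

lemma tol_map_Leaf: "tol (map (\<lambda>_. Leaf) xs) = tree_of_nat (length xs)"
  by (induction xs) auto

lemma reduction_parameter_eq:
  fixes \<kappa> d :: nat and k :: tree
  defines "\<kappa> \<equiv> (nat_of k + 3) ^ 2 ^ d"
  shows "reduction_parameter d k = tree_of_nat (\<kappa> + (\<kappa> choose 2) + (\<kappa> - 2))"
proof -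
  have "reduction_parameter d k = tree_of_nat (nat_of (slotsT d k) + (nat_of (slotsT d k) choose 2) +
      nat_of (right (right (slotsT d k))))"
    unfolding reduction_parameter_def Let_def tol_map_Leaf by (simp add: length_pairsT add.assoc)
  then show ?thesis unfolding nat_of_right diff_diff_left one_add_one nat_of_slotsT \<kappa>_def .
qed

text \<open>Injectivity of \<open>f\<close> is not assumed: by irreflexivity of \<open>B\<close> a
  clique never contains two elements with the same image, and conversely one preimage of each
  element is chosen. So several candidates may represent the same token list.\<close>

lemma ex_clique_image_iff:
  assumes f: "f ` X = Y" and A: "\<And>a b. a \<in> X \<Longrightarrow> b \<in> X \<Longrightarrow> A a b \<longleftrightarrow> B (f a) (f b)"
    and irrefl: "\<And>y. \<not> B y y"
  shows "(\<exists>K\<subseteq>X. card K = n \<and> (\<forall>a\<in>K. \<forall>b\<in>K. a \<noteq> b \<longrightarrow> A a b)) \<longleftrightarrow>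
    (\<exists>K\<subseteq>Y. card K = n \<and> (\<forall>a\<in>K. \<forall>b\<in>K. a \<noteq> b \<longrightarrow> B a b))"
proof
  assume "\<exists>K\<subseteq>X. card K = n \<and> (\<forall>a\<in>K. \<forall>b\<in>K. a \<noteq> b \<longrightarrow> A a b)"
  then obtain K where K: "K \<subseteq> X" "card K = n" "\<And>a b. a \<in> K \<Longrightarrow> b \<in> K \<Longrightarrow> a \<noteq> b \<Longrightarrow> A a b" by blast
  have B: "B (f a) (f b)" if "a \<in> K" "b \<in> K" "a \<noteq> b" for a b
    using K(3)[OF that] A that K(1) by blast
  then have "inj_on f K" using irrefl by (metis inj_onI)
  then have "card (f ` K) = n" using K(2) card_image by metis
  then show "\<exists>K\<subseteq>Y. card K = n \<and> (\<forall>a\<in>K. \<forall>b\<in>K. a \<noteq> b \<longrightarrow> B a b)"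
    using B f K(1) by (intro exI[of _ "f ` K"]) blast
next
  assume "\<exists>K\<subseteq>Y. card K = n \<and> (\<forall>a\<in>K. \<forall>b\<in>K. a \<noteq> b \<longrightarrow> B a b)"
  then obtain K where K: "K \<subseteq> Y" "card K = n" "\<And>a b. a \<in> K \<Longrightarrow> b \<in> K \<Longrightarrow> a \<noteq> b \<Longrightarrow> B a b" by blast
  then obtain J where J: "J \<subseteq> X" "inj_on f J" "K = f ` J"
    using f subset_image_inj by metis
  have "card J = n" using J K(2) card_image by metis
  moreover have "A a b" if "a \<in> J" "b \<in> J" "a \<noteq> b" for a b
    using A[of a b] K(3)[of "f a" "f b"] that J by (auto dest: inj_onD)
  ultimately show "\<exists>K\<subseteq>X. card K = n \<and> (\<forall>a\<in>K. \<forall>b\<in>K. a \<noteq> b \<longrightarrow> A a b)" using J(1) by blast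
qed

lemma reduction_instance_correct:
  assumes AV: "AV_uniform \<phi>" and ok: "circuit_ok x" and weft: "weft1_le (gateT x) d (nat_of (right x))"
  shows "valid_instance (dcav_of (reduction_instance d x k)) \<and> controllable \<phi> (dcav_of (reduction_instance d x k)) \<longleftrightarrow>
    (\<exists>S\<subseteq>inputs (circuit_of x). card S = nat_of k \<and> satisfies S (circuit_of x))"
proof -
  let ?\<kappa> = "(nat_of k + 3) ^ 2 ^ d"
  define v where "v = tol (verticesT d x k)"
  define A where "A a b \<longleftrightarrow> adjacentT (2 ^ d) (vertexT v a) (vertexT v b)" for a b
  let ?f = "\<lambda>a. map tokT (list_of (vertexT v a))"
  have "nat_of k + 3 \<le> ?\<kappa>" by (rule self_le_power) auto
  then have \<kappa>: "3 \<le> ?\<kappa>" by linarith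
  have v: "vertexT v ` {1..nat_of v} = set (verticesT d x k)"
    unfolding vertexT_image by (simp add: v_def)
  have "valid_instance (dcav_of (reduction_instance d x k)) \<and> controllable \<phi> (dcav_of (reduction_instance d x k)) \<longleftrightarrow>
      (\<exists>K\<subseteq>{1..nat_of v}. card K = ?\<kappa> \<and> (\<forall>a\<in>K. \<forall>b\<in>K. a \<noteq> b \<longrightarrow> A a b))"
    unfolding dcav_of_reduction_instance v_def[symmetric]
    by (rule clique_instance_correct[OF AV \<kappa>]) (auto simp: A_def edgesT_def intro: adjacentT_sym)
  also have "\<dots> \<longleftrightarrow> (\<exists>K\<subseteq>vertices (gateT x) (nat_of x) (nat_of k) d (2 ^ d). card K = ?\<kappa> \<and>
      (\<forall>T\<in>K. \<forall>T'\<in>K. T \<noteq> T' \<longrightarrow> adjacent (2 ^ d) T T'))"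
  proof (rule ex_clique_image_iff[where f = ?f])
    show "?f ` {1..nat_of v} = vertices (gateT x) (nat_of x) (nat_of k) d (2 ^ d)"
      unfolding verticesT_eq[symmetric] v[symmetric] by (simp add: image_image)
    show "A a b \<longleftrightarrow> adjacent (2 ^ d) (?f a) (?f b)" if "a \<in> {1..nat_of v}" "b \<in> {1..nat_of v}" for a b
    proof -
      have "vertexT v a \<in> set (verticesT d x k)" "vertexT v b \<in> set (verticesT d x k)"
        using that v by blast+
      then show ?thesis unfolding A_def by (intro adjacentT_iff length_verticesT)
    qed
    show "\<not> adjacent (2 ^ d) T T" for T by (simp add: adjacent_def)
  qed
  also have "\<dots> \<longleftrightarrow> (\<exists>S\<subseteq>inputs (circuit_of x). card S = nat_of k \<and> satisfies S (circuit_of x))"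
    using clique_iff_satisfiable[of "circuit_of x" "gateT x" d "2 ^ d" "nat_of k"] gateT_eq_nth ok weft
    by (simp add: circuit_ok_iff nat_of_right)
  finally show ?thesis .
qed

text \<open>All instances built meet the restriction, so one reduction serves both problems. The
  parameter is the sum of \<kappa>, \<kappa> choose 2 and \<open>\<kappa> - 2\<close>, each at most
  the square of \<kappa>, whence the factor 3.\<close>

lemma reduction_correct:
  assumes AV: "AV_uniform \<phi>" and L: "L = DCAV \<phi> \<or> L = DCAV_restricted \<phi>"
  shows "\<exists>x' k'. reduction d (Node x (tree_of_nat k)) = Node x' (tree_of_nat k') \<and>
    k' \<le> 3 * ((k + 3) ^ 2 ^ d) ^ 2 \<and> ((x, k) \<in> weighted_circuit_sat 1 d \<longleftrightarrow> (x', k') \<in> L)"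
proof (cases "circuit_ok x \<and> weft1_le (gateT x) d (nat_of (right x))")
  case True
  let ?k = "tree_of_nat k"
  let ?I = "dcav_of (reduction_instance d x ?k)"
  define \<kappa> where "\<kappa> = (k + 3) ^ 2 ^ d"
  define k' where "k' = \<kappa> + (\<kappa> choose 2) + (\<kappa> - 2)"
  have red: "reduction d (Node x ?k) = Node (reduction_instance d x ?k) (tree_of_nat k')"
    using True by (simp add: reduction_def reduction_parameter_eq k'_def \<kappa>_def)
  have "\<kappa> \<le> \<kappa>\<^sup>2" by (simp add: power2_eq_square)
  moreover have "\<kappa> choose 2 \<le> \<kappa>\<^sup>2"
  proof -
    have "2 * (\<kappa> choose 2) \<le> \<kappa> * \<kappa>" unfolding two_choose_two by (rule mult_left_mono) auto
    then show ?thesis by (simp add: power2_eq_square)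
  qed
  ultimately have "k' \<le> 3 * ((k + 3) ^ 2 ^ d) ^ 2" unfolding k'_def \<kappa>_def[symmetric] by linarith
  moreover have "k' = committee_size ?I + budget ?I + size (registered ?I)"
    unfolding dcav_of_reduction_instance by (simp add: clique_instance_def k'_def \<kappa>_def)
  then have "(reduction_instance d x ?k, k') \<in> DCAV \<phi> \<longleftrightarrow> valid_instance ?I \<and> controllable \<phi> ?I"
    by (auto simp: DCAV_def)
  moreover have "card (distinguished ?I) = 1 \<and> (\<forall>v \<in># registered ?I + unregistered ?I. card v = 2)"
    unfolding dcav_of_reduction_instance
    by (auto simp: clique_instance_def finite_edgesT card_edgesT card_insert_if)
  then have "(reduction_instance d x ?k, k') \<in> DCAV_restricted \<phi> \<longleftrightarrow> (reduction_instance d x ?k, k') \<in> DCAV \<phi>"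
    by (auto simp: DCAV_restricted_def)
  moreover have "(x, k) \<in> weighted_circuit_sat 1 d \<longleftrightarrow>
      (\<exists>S\<subseteq>inputs (circuit_of x). card S = k \<and> satisfies S (circuit_of x))"
    using True weft1_le_correct[of "circuit_of x" "gateT x" d] gateT_eq_nth
    by (auto simp: weighted_circuit_sat_def circuit_ok_iff nat_of_right)
  ultimately show ?thesis
    using red reduction_instance_correct[OF AV, of x d ?k] True L unfolding nat_of_tree_of_nat by metis
next
  case False
  then have "reduction d (Node x (tree_of_nat k)) = Node Leaf (tree_of_nat 0)"
    by (auto simp: reduction_def)
  moreover have "(Leaf, 0) \<notin> L"
    using L by (auto simp: DCAV_restricted_def DCAV_def valid_instance_def dcav_of_def cand_set_of_def nat_list_of_def)
  moreover have "(x, k) \<notin> weighted_circuit_sat 1 d"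
    using False weft1_le_correct[of "circuit_of x" "gateT x" d] gateT_eq_nth
    by (auto simp: weighted_circuit_sat_def circuit_ok_iff nat_of_right)
  ultimately show ?thesis by (intro exI[of _ Leaf] exI[of _ 0]) simp
qed

section \<open>Hardness\<close>

lemma computable_comp: assumes "computable f" "computable g" shows "computable (\<lambda>n. f (g n))"
proof -
  obtain P Q where "\<forall>n. \<exists>t. runs P (tree_of_nat n) (tree_of_nat (f n)) t"
    "\<forall>n. \<exists>t. runs Q (tree_of_nat n) (tree_of_nat (g n)) t"
    using assms unfolding computable_def by blast
  then have "\<forall>n. \<exists>t. runs (Seq Q P) (tree_of_nat n) (tree_of_nat (f (g n))) t"
    using run_Seq by meson
  then show ?thesis unfolding computable_def by blast
qed

lemma computable_binary:
  assumes F: "fp F" "\<And>m n. F (Node (tree_of_nat m) (tree_of_nat n)) = tree_of_nat (h m n)"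
    and "computable f" "computable g"
  shows "computable (\<lambda>n. h (f n) (g n))"
proof -
  obtain P Q where *: "\<forall>n. \<exists>t. runs P (tree_of_nat n) (tree_of_nat (f n)) t"
    "\<forall>n. \<exists>t. runs Q (tree_of_nat n) (tree_of_nat (g n)) t"
    using assms unfolding computable_def by blast
  obtain R where R: "\<And>x. \<exists>t. runs R x (F x) t" using F(1) unfolding fp_def by blast
  have "\<exists>t. runs (Seq (Pair P Q) R) (tree_of_nat n) (tree_of_nat (h (f n) (g n))) t" for n
    using * R[of "Node (tree_of_nat (f n)) (tree_of_nat (g n))"] run_Seq run_Pair unfolding F(2) by meson
  then show ?thesis unfolding computable_def by blast
qed

lemma tree_of_nat_eq: "tree_of_nat n = tol (replicate n Leaf)"
  by (induction n) auto

lemma computable_const: "computable (\<lambda>_. c)"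
  using fp_const[of "tree_of_nat c"] unfolding computable_def fp_def by blast

lemma computable_id: "computable (\<lambda>n. n)"
  unfolding computable_def using run_Id by blast

lemma computable_add: "computable f \<Longrightarrow> computable g \<Longrightarrow> computable (\<lambda>n. f n + g n)"
  by (rule computable_binary[where h = "(+)" and f = f and g = g and F = "\<lambda>z. tol (list_of (left z) @ list_of (right z))"])
    (intro fp_intros, simp add: tree_of_nat_eq replicate_add)

lemma computable_mult: "computable f \<Longrightarrow> computable g \<Longrightarrow> computable (\<lambda>n. f n * g n)"
proof (rule computable_binary[where h = "(*)" and f = f and g = g and F = "\<lambda>z. tol (concat (map (\<lambda>_. list_of (right z)) (list_of (left z))))"])
  have "concat (map (\<lambda>_. replicate n Leaf) (replicate m Leaf)) = replicate (m * n) Leaf" for m n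
    by (induction m) (simp_all add: replicate_add)
  then show "tol (concat (map (\<lambda>_. list_of (right (Node (tree_of_nat m) (tree_of_nat n))))
      (list_of (left (Node (tree_of_nat m) (tree_of_nat n)))))) = tree_of_nat (m * n)" for m n
    by (simp add: tree_of_nat_eq)
qed (intro fp_intros)

lemma computable_power: "computable f \<Longrightarrow> computable (\<lambda>n. f n ^ c)"
  by (induction c) (simp_all add: computable_const computable_mult)

text \<open>The second program is polynomial in the output of the first, including the unary
  parameter, and that output is bounded by the running time of the first. Monotonicity of
  \<open>h\<close> is needed since the intermediate parameter is only bounded by
  \<open>g k\<close>.\<close>

lemma fpt_reducible_fp:
  assumes L: "fpt_reducible L L'" and R: "fp R" and h: "computable h" "mono h"
    and correct: "\<And>x k. \<exists>x' k'. R (Node x (tree_of_nat k)) = Node x' (tree_of_nat k') \<and> k' \<le> h k \<and>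
      ((x, k) \<in> L' \<longleftrightarrow> (x', k') \<in> L'')"
  shows "fpt_reducible L L''"
proof -
  obtain P f g c where f: "computable f" and g: "computable g"
    and P: "\<And>x k. \<exists>x' k' t. runs P (Node x (tree_of_nat k)) (Node x' (tree_of_nat k')) t \<and>
        t \<le> f k * nodes x ^ c \<and> k' \<le> g k \<and> ((x, k) \<in> L \<longleftrightarrow> (x', k') \<in> L')"
    using L unfolding fpt_reducible_def by blast
  obtain Q b where Q: "\<And>x. \<exists>t\<le>b * nodes x ^ b. runs Q x (R x) t" using R by (rule fpE) blast
  \<comment> \<open>With \<open>T\<close> bounding the first run, the total cost is at most
    \<open>T + b * T ^ b\<close>; the exponent \<open>1 + b\<close> covers both summands because
    \<open>T\<close> is at least 1.\<close>
  let ?f = "\<lambda>k. (1 + b) * f k ^ (1 + b)"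
  show ?thesis unfolding fpt_reducible_def
  proof (rule exI[of _ "Seq P Q"], rule exI[of _ ?f], rule exI[of _ "\<lambda>k. h (g k)"],
      rule exI[of _ "c * (1 + b)"], intro conjI allI)
    show "computable ?f" by (intro computable_mult computable_const computable_power f)
    show "computable (\<lambda>k. h (g k))" by (rule computable_comp[OF h(1) g])
    fix x k
    obtain x1 k1 t where 1: "runs P (Node x (tree_of_nat k)) (Node x1 (tree_of_nat k1)) t"
      "t \<le> f k * nodes x ^ c" "k1 \<le> g k" "(x, k) \<in> L \<longleftrightarrow> (x1, k1) \<in> L'" using P by blast
    obtain x' k' where 2: "R (Node x1 (tree_of_nat k1)) = Node x' (tree_of_nat k')" "k' \<le> h k1"
      "(x1, k1) \<in> L' \<longleftrightarrow> (x', k') \<in> L''" using correct by blast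
    obtain u where u: "u \<le> b * nodes (Node x1 (tree_of_nat k1)) ^ b"
      "runs Q (Node x1 (tree_of_nat k1)) (Node x' (tree_of_nat k')) u" using Q 2(1) by metis
    define T where "T = f k * nodes x ^ c"
    have t: "t \<le> T" using 1(2) by (simp add: T_def)
    have n: "nodes (Node x1 (tree_of_nat k1)) \<le> T" using runs_nodes[OF 1(1)] t by linarith
    then have T: "1 \<le> T" using nodes_ge_1[of "Node x1 (tree_of_nat k1)"] by linarith
    have "u \<le> b * T ^ b" using u(1) mult_left_mono[OF power_mono[OF n], of b b] by linarith
    also have "\<dots> \<le> b * T ^ (1 + b)" using T by (intro mult_left_mono power_increasing) auto
    finally have "u \<le> b * T ^ (1 + b)" .
    moreover have "T \<le> T ^ (1 + b)" using self_le_power[of T "1 + b"] T by simp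
    ultimately have "t + u \<le> T ^ (1 + b) + b * T ^ (1 + b)" using t by linarith
    also have "\<dots> = (1 + b) * T ^ (1 + b)" by (simp only: add_mult_distrib mult_1)
    also have "T ^ (1 + b) = f k ^ (1 + b) * nodes x ^ (c * (1 + b))"
      unfolding T_def power_mult_distrib power_mult ..
    also have "(1 + b) * \<dots> = ?f k * nodes x ^ (c * (1 + b))" by (simp only: mult.assoc)
    finally have "t + u \<le> ?f k * nodes x ^ (c * (1 + b))" .
    moreover have "k' \<le> h (g k)" using 2(2) monoD[OF h(2) 1(3)] by linarith
    ultimately show "\<exists>x' k' t. runs (Seq P Q) (Node x (tree_of_nat k)) (Node x' (tree_of_nat k')) t \<and>
        t \<le> ?f k * nodes x ^ (c * (1 + b)) \<and> k' \<le> h (g k) \<and> ((x, k) \<in> L \<longleftrightarrow> (x', k') \<in> L'')"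
      using run_Seq[OF 1(1) u(2)] 1(4) 2(3) by blast
  qed
qed

theorem theorem10:
  fixes \<phi> :: rule
  assumes "ABMV_rule \<phi>" and "AV_uniform \<phi>"
  shows "W_hard 1 (DCAV \<phi>) \<and> W_hard 1 (DCAV_restricted \<phi>)"
proof -
  have "W_hard 1 L" if L: "L = DCAV \<phi> \<or> L = DCAV_restricted \<phi>" for L
    unfolding W_hard_def
  proof
    \<comment> \<open>Each \<open>L'\<close> brings its own depth \<open>d\<close>. The reduction
      may depend on it, so \<open>2 ^ d\<close> is a constant in exponents.\<close>
    fix L' assume "L' \<in> W 1"
    then obtain d where d: "fpt_reducible L' (weighted_circuit_sat 1 d)" unfolding W_def by blast
    show "fpt_reducible L' L"
    proof (rule fpt_reducible_fp[OF d fp_reduction])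
      show "computable (\<lambda>k. 3 * ((k + 3) ^ 2 ^ d) ^ 2)"
        by (intro computable_mult computable_const computable_power computable_add computable_id)
      show "mono (\<lambda>k::nat. 3 * ((k + 3) ^ 2 ^ d) ^ 2)"
        by (intro monoI mult_left_mono power_mono add_right_mono) auto
    qed (rule reduction_correct[OF assms(2) L])
  qed
  then show ?thesis by blast
qed

end
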